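(* Let $t$ be a positive integer. (i) If $t\equiv 0\pmod 3$ and there exists an $SRG\left(n,\frac{n-1}{2},\frac{n-5}{4},\frac{n-1}{4}\right)$ with $n=\frac{4t}{3}+1$, then $r'_2(K_{2,t})=CR(K_{2,t},K_3)=\frac{4t}{3}+2$. (ii) If $t\equiv 0\pmod 2$ and there exists an $SRG\left(2t+1,t,\frac{t}{2}-1,\frac{t}{2}\right)$, then $r'_2(K_{3,t})=CR(K_{3,t},K_3)=2t+2$.
   Context: $SRG(n,k,\lambda,\mu)$ denotes a strongly regular graph with parameters $(n,k,\lambda,\mu)$: a $k$-regular graph on $n$ vertices in which any two adjacent vertices have exactly $\lambda$ common neighbors and any two distinct nonadjacent vertices have exactly $\mu$ common neighbors. An edge-colored graph $G$ on $p$ vertices with edge-coloring $\chi$ is called orderable if there exist an ordering $(v_1,\ldots,v_p)$ of $V(G)$ and a list $(c_1,\ldots,c_{p-1})$ of not necessarily distinct colors such that for every edge $v_iv_j\in E(G)$ with $i<j$ we have $\chi(v_iv_j)=c_i$. An edge-colored graph is rainbow if all its edges have pairwise different colors. For a graph $G$, $r'_2(G)$ is the minimum integer $n$ such that every 2-edge-coloring of $K_n$ (each edge gets one of two given colors) contains an orderable copy of $G$. For graphs $G,H$, $CR(G,H)$ is the minimum integer $n$ such that every edge-coloring of $K_n$ with any number of colors contains either an orderable copy of $G$ or a rainbow copy of $H$. Copies are (not necessarily induced) subgraphs with the inherited coloring. *)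

theory Defs
  imports Main "HOL-Library.Extended_Nat"
begin

record 'a sgraph =
  verts :: "'a set"
  edges :: "'a set set"

definition simple_graph :: "'a sgraph \<Rightarrow> bool" where
  "simple_graph G \<longleftrightarrow>
     finite (verts G) \<and> (\<forall>e\<in>edges G. e \<subseteq> verts G \<and> card e = 2)"

definition nbrs :: "'a sgraph \<Rightarrow> 'a \<Rightarrow> 'a set" where
  "nbrs G v = {w \<in> verts G. {v, w} \<in> edges G}"

definition is_SRG :: "'a sgraph \<Rightarrow> nat \<Rightarrow> nat \<Rightarrow> nat \<Rightarrow> nat \<Rightarrow> bool" where
  "is_SRG G n k l m \<longleftrightarrow>
     simple_graph G \<and> card (verts G) = n \<and>
     (\<forall>v\<in>verts G. card (nbrs G v) = k) \<and>
     (\<forall>u\<in>verts G. \<forall>v\<in>verts G. {u, v} \<in> edges G \<longrightarrow>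
        card (nbrs G u \<inter> nbrs G v) = l) \<and>
     (\<forall>u\<in>verts G. \<forall>v\<in>verts G. u \<noteq> v \<and> {u, v} \<notin> edges G \<longrightarrow>
        card (nbrs G u \<inter> nbrs G v) = m)"

text \<open>Every finite graph is isomorphic to one whose vertices are natural numbers, so
  ranging over graphs on \<^typ>\<open>nat\<close> loses nothing.\<close>

definition SRG_exists :: "nat \<Rightarrow> nat \<Rightarrow> nat \<Rightarrow> nat \<Rightarrow> bool" where
  "SRG_exists n k l m \<longleftrightarrow> (\<exists>G :: nat sgraph. is_SRG G n k l m)"

definition complete_graph :: "nat \<Rightarrow> nat sgraph" where
  "complete_graph n = \<lparr>verts = {..<n}, edges = {e. e \<subseteq> {..<n} \<and> card e = 2}\<rparr>"

definition complete_bipartite :: "nat \<Rightarrow> nat \<Rightarrow> nat sgraph" where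
  "complete_bipartite s t =
     \<lparr>verts = {..<s + t}, edges = {{i, j} | i j. i < s \<and> s \<le> j \<and> j < s + t}\<rparr>"

definition subgraph_of :: "'a sgraph \<Rightarrow> 'a sgraph \<Rightarrow> bool" where
  "subgraph_of C H \<longleftrightarrow> simple_graph C \<and> verts C \<subseteq> verts H \<and> edges C \<subseteq> edges H"

definition isomorphic :: "'a sgraph \<Rightarrow> 'b sgraph \<Rightarrow> bool" where
  "isomorphic G H \<longleftrightarrow>
     (\<exists>f. bij_betw f (verts G) (verts H) \<and> edges H = (\<lambda>e. f ` e) ` edges G)"

definition copy_of_in :: "'b sgraph \<Rightarrow> 'a sgraph \<Rightarrow> 'b sgraph \<Rightarrow> bool" where
  "copy_of_in C G H \<longleftrightarrow> subgraph_of C H \<and> isomorphic G C"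

text \<open>An edge-coloring is a total function on sets of vertices; only its values on edges
  matter, so a subgraph inherits the coloring by using the same function. Lists are indexed
  from 0.\<close>

definition orderable :: "'a sgraph \<Rightarrow> ('a set \<Rightarrow> 'c) \<Rightarrow> bool" where
  "orderable G \<chi> \<longleftrightarrow>
     (\<exists>vs cs. distinct vs \<and> set vs = verts G \<and> length cs = card (verts G) - 1 \<and>
        (\<forall>i j. i < j \<and> j < card (verts G) \<and> {vs ! i, vs ! j} \<in> edges G \<longrightarrow>
           \<chi> {vs ! i, vs ! j} = cs ! i))"

definition rainbow :: "'a sgraph \<Rightarrow> ('a set \<Rightarrow> 'c) \<Rightarrow> bool" where
  "rainbow G \<chi> \<longleftrightarrow> inj_on \<chi> (edges G)"

text \<open>The minima below are infima in \<^typ>\<open>enat\<close>: if no \<open>n\<close> qualifies the value is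
  \<open>\<infinity>\<close>, and a finite value is attained.\<close>

definition orderable_ramsey2 :: "'a sgraph \<Rightarrow> enat" where
  "orderable_ramsey2 G = Inf {enat n | n.
     \<forall>\<chi> :: nat set \<Rightarrow> nat. \<chi> ` edges (complete_graph n) \<subseteq> {0, 1} \<longrightarrow>
       (\<exists>C. copy_of_in C G (complete_graph n) \<and> orderable C \<chi>)}"

text \<open>Colors are natural numbers, which is enough for any number of colors, since
  \<open>K\<^sub>n\<close> has finitely many edges.\<close>

definition CR :: "'a sgraph \<Rightarrow> 'b sgraph \<Rightarrow> enat" where
  "CR G H = Inf {enat n | n.
     \<forall>\<chi> :: nat set \<Rightarrow> nat.
       (\<exists>C. copy_of_in C G (complete_graph n) \<and> orderable C \<chi>) \<or>
       (\<exists>C. copy_of_in C H (complete_graph n) \<and> rainbow C \<chi>)}"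

end

(* Ordering a copy of K_{2,t} or K_{3,t} by the positions of its small part {a, b} or {a, b, d} shows
   that orderability is a local condition on the colours that each vertex of the large part sends to
   the small part. For the upper bound, Gallai's theorem splits a colouring without rainbow triangles
   into homogeneous classes joined by at most two colours. A vertex outside a class sends a single
   colour to it, so one may pass to a class with enough vertices; otherwise the colouring is
   essentially 2-coloured and averaging over all choices of the small part gives the bound. For the
   lower bound, colour the edges and non-edges of the strongly regular graph: for vertices a and b and
   distinct colours X and Y, exactly (n - 1) / 4 vertices send X to a and Y to b. *)

theory Submission imports Defs
begin

section \<open>Gallai partitions\<close>

text \<open>Both statements live on one family of graphs: with s = t/3 in (i) and s = t/2 in (ii),
  the strongly regular graph has parameters (4s+1, 2s, s-1, s) and the Ramsey number is 4s+2. The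
  bounds meet because the same number of misfits decides both sides. On 4s+2 vertices some small
  part has at most s misfits (two vertices) or 2s-1 misfits (three vertices); on 4s+1 vertices the
  strongly regular colouring forces at least that many for every small part, and the missing vertex
  makes the large part one too small. The averaging counts triples in which a vertex sends different
  colours to two others. Such counts are largest when every vertex splits the rest evenly between
  two colours, which is what a conference graph does. Passing to a class fails in one situation: for
  three vertices, when the class has only two. That case needs an argument of its own. One upper and
  one lower estimate serve both Ramsey numbers, since a triangle has three edges and so is never
  rainbow in two colours.\<close>

locale sym_coloring =
  fixes c :: "'a \<Rightarrow> 'a \<Rightarrow> 'b"
  assumes comm: "c x y = c y x"
begin

definition no_rainbow :: "'a set \<Rightarrow> bool" where
  "no_rainbow V \<longleftrightarrow> (\<forall>x\<in>V. \<forall>y\<in>V. \<forall>z\<in>V. x \<noteq> y \<and> y \<noteq> z \<and> x \<noteq> z \<longrightarrow>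
     c x y = c y z \<or> c x y = c x z \<or> c y z = c x z)"

definition used :: "'b \<Rightarrow> 'a set \<Rightarrow> bool" where
  "used d V \<longleftrightarrow> (\<exists>x\<in>V. \<exists>y\<in>V. x \<noteq> y \<and> c x y = d)"

text \<open>Disconnectedness of the graph formed by the edges of colour \<open>d\<close>. It is
  phrased with a cut because the three-colour argument always exhibits an explicit set, a single
  vertex or a component.\<close>

definition has_cut :: "'b \<Rightarrow> 'a set \<Rightarrow> bool" where
  "has_cut d V \<longleftrightarrow> (\<exists>S\<subseteq>V. S \<noteq> {} \<and> S \<noteq> V \<and> (\<forall>x\<in>S. \<forall>y\<in>V - S. c x y \<noteq> d))"

definition color_rel :: "'b \<Rightarrow> 'a set \<Rightarrow> ('a \<times> 'a) set" where
  "color_rel d V = {(x, y). x \<in> V \<and> y \<in> V \<and> c x y = d}"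

definition component :: "'b \<Rightarrow> 'a set \<Rightarrow> 'a \<Rightarrow> 'a set" where
  "component d V x = {y. (x, y) \<in> (color_rel d V)\<^sup>*}"

section \<open>Components of a single colour\<close>

lemma no_rainbow_subset: "no_rainbow V \<Longrightarrow> W \<subseteq> V \<Longrightarrow> no_rainbow W"
  unfolding no_rainbow_def by blast

lemma no_rainbowD:
  assumes "no_rainbow V" "x \<in> V" "y \<in> V" "z \<in> V" "x \<noteq> y" "y \<noteq> z" "x \<noteq> z"
  shows "c x y = c y z \<or> c x y = c x z \<or> c y z = c x z"
  using assms unfolding no_rainbow_def by blast

lemma component_self: "x \<in> component d V x"
  by (simp add: component_def)

lemma component_subset:
  assumes "x \<in> V" shows "component d V x \<subseteq> V"
proof
  fix y assume "y \<in> component d V x"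
  then have "(x, y) \<in> (color_rel d V)\<^sup>*" by (simp add: component_def)
  then show "y \<in> V" by (induction) (use assms in \<open>auto simp: color_rel_def\<close>)
qed

lemma component_closed:
  assumes "x \<in> V" "y \<in> component d V x" "z \<in> V" "c y z = d"
  shows "z \<in> component d V x"
proof -
  have "y \<in> V" using assms component_subset by blast
  then have "(y, z) \<in> color_rel d V" using assms by (simp add: color_rel_def)
  then show ?thesis using assms(2) by (auto simp: component_def intro: rtrancl_into_rtrancl)
qed

lemma component_meet:
  assumes "w \<in> component d V x" "w \<in> component d V y"
  shows "y \<in> component d V x"
proof -
  have "sym ((color_rel d V)\<^sup>*)"
    by (intro sym_rtrancl) (auto simp: sym_def color_rel_def comm)
  then show ?thesis using assms unfolding component_def
    by (metis mem_Collect_eq rtrancl_trans symD)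
qed

text \<open>A vertex outside a component of colour \<open>d\<close> sends no edge of colour \<open>d\<close> to it, so
  absence of rainbow triangles propagates its colour along the edges of colour \<open>d\<close>.\<close>

lemma component_homogeneous:
  assumes "no_rainbow V" "x \<in> V" "y \<in> component d V x" "y' \<in> component d V x"
    and "z \<in> V" "z \<notin> component d V x"
  shows "c z y = c z y'"
proof -
  have *: "c z w = c z x" if "w \<in> component d V x" for w
  proof -
    have "(x, w) \<in> (color_rel d V)\<^sup>*" using that by (simp add: component_def)
    then show ?thesis
    proof induction
      case (step u w)
      have u: "u \<in> component d V x" using step.hyps by (simp add: component_def)
      have w: "w \<in> component d V x"
        using step.hyps by (auto simp: component_def intro: rtrancl_into_rtrancl)
      have uw: "u \<in> V" "w \<in> V" "c u w = d" using step.hyps by (auto simp: color_rel_def)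
      have "c u z \<noteq> d" "c w z \<noteq> d" using component_closed u w assms by blast+
      moreover have "z \<noteq> u" "z \<noteq> w" using u w assms by auto
      ultimately have "c z u = c z w"
        using no_rainbowD[OF assms(1) assms(5) uw(1,2)] uw(3) comm by metis
      then show ?case using step.IH by simp
    qed simp
  qed
  show ?thesis using * assms by simp
qed

lemma component_proper:
  assumes "has_cut d V" "x \<in> V"
  shows "component d V x \<noteq> V"
proof -
  obtain S where S: "S \<subseteq> V" "S \<noteq> {}" "S \<noteq> V" "\<forall>x\<in>S. \<forall>y\<in>V - S. c x y \<noteq> d"
    using assms(1) unfolding has_cut_def by auto
  \<comment> \<open>No edge of colour \<open>d\<close> crosses the cut, so a path from
    \<open>x\<close> stays on its side.\<close>
  have side: "y \<in> S \<longleftrightarrow> x \<in> S" if "y \<in> component d V x" for y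
  proof -
    have "(x, y) \<in> (color_rel d V)\<^sup>*" using that by (simp add: component_def)
    then show ?thesis
      by induction (use S(4) comm in \<open>auto simp: color_rel_def; metis Diff_iff\<close>)+
  qed
  obtain u w where "u \<in> S" "w \<in> V - S" using S by blast
  then show ?thesis using side S(1) by blast
qed

text \<open>Induction on the vertices. If every colour in use were connected after adding
  \<open>v\<close>, then deleting \<open>v\<close> would keep all colours in use, so some colour
  \<open>d\<close> is disconnected without \<open>v\<close>. The vertex \<open>v\<close> has to
  repair this by reaching every component of \<open>d\<close>, and that rigidity disconnects a third
  colour.\<close>

lemma has_cut_of_three_colors:
  assumes "finite V" "no_rainbow V"
    and "used d1 V" "used d2 V" "used d3 V" "d1 \<noteq> d2" "d1 \<noteq> d3" "d2 \<noteq> d3"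
  shows "\<exists>d. used d V \<and> has_cut d V"
  using assms
proof (induction V rule: finite_induct)
  case empty
  then show ?case by (simp add: used_def)
next
  case (insert v V)
  let ?W = "insert v V"
  have nrV: "no_rainbow V" using insert.prems(1) no_rainbow_subset by blast
  show ?case
  proof (rule ccontr)
    assume "\<not> ?thesis"
    then have conn: "\<not> has_cut d ?W" if "used d ?W" for d using that by blast
    \<comment> \<open>If \<open>v\<close> sends one colour to everything, it is isolated in every
      other colour.\<close>
    have star: False if "\<forall>y\<in>V. c v y = d" "used e ?W" "d \<noteq> e" for d e
    proof -
      have "V \<noteq> {}" using that(2) by (auto simp: used_def)
      then have "has_cut e ?W" unfolding has_cut_def
        using that insert.hyps by (intro exI[of _ "{v}"]) auto
      then show False using conn that by blast
    qed
    \<comment> \<open>If \<open>d\<close> occurred only at \<open>v\<close>, a vertex not joined to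
      \<open>v\<close> by \<open>d\<close> would be isolated in \<open>d\<close>;
      \<open>star\<close> provides such a vertex. Hence the induction hypothesis applies to
      \<open>V\<close>.\<close>
    have keep: "used d V" if "used d ?W" "used e ?W" "d \<noteq> e" for d e
    proof (rule ccontr)
      assume no: "\<not> used d V"
      show False
      proof (cases "\<forall>y\<in>V. c v y = d")
        case True
        then show False using star that by blast
      next
        case False
        then obtain y where y: "y \<in> V" "c v y \<noteq> d" by blast
        have "c y z \<noteq> d" if "z \<in> ?W - {y}" for z
          using that y no comm by (cases "z = v") (auto simp: used_def)
        then have "has_cut d ?W" unfolding has_cut_def
          using y insert.hyps by (intro exI[of _ "{y}"]) auto
        then show False using conn that by blast
      qed
    qed
    obtain d where d: "used d V" "has_cut d V"
      using insert.IH[OF nrV] keep insert.prems by metis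
    have dW: "used d ?W" using d(1) by (auto simp: used_def)
    \<comment> \<open>A component that \<open>v\<close> does not reach in colour \<open>d\<close>
      would be a cut for \<open>d\<close> in \<open>?W\<close>.\<close>
    have hit: "\<exists>y\<in>component d V x. c v y = d" if "x \<in> V" for x
    proof (rule ccontr)
      assume no: "\<not> ?thesis"
      let ?S = "component d V x"
      have sub: "?S \<subseteq> V" using that component_subset by blast
      have "c y z \<noteq> d" if "y \<in> ?S" "z \<in> ?W - ?S" for y z
        using that no comm component_closed[OF \<open>x \<in> V\<close>] by (cases "z = v") auto
      then have "has_cut d ?W" unfolding has_cut_def
        using sub insert.hyps component_self[of x d V] by (intro exI[of _ ?S]) auto
      then show False using conn dW by blast
    qed
    \<comment> \<open>Every other component contains some \<open>x\<close> with
      \<open>c v x = d\<close>. In the triangle \<open>v, x, y\<close> the edge \<open>x y\<close>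
      leaves \<open>?S\<close>, so it is not \<open>d\<close> and must be \<open>e\<close>.
      Homogeneity, used on both sides, spreads \<open>e\<close> over all edges between
      \<open>?S\<close> and the rest of \<open>V\<close>.\<close>
    have third: "has_cut e' ?W" if y: "y \<in> V" "c v y = e" "e \<noteq> d" and e': "e' \<noteq> d" "e' \<noteq> e" for y e e'
    proof -
      let ?S = "component d V y"
      have sub: "?S \<subseteq> V" using y component_subset by blast
      have out: "\<exists>x\<in>component d V z. c v x = d \<and> (\<forall>y'\<in>?S. c x y' = e)"
        if z: "z \<in> V - ?S" for z
      proof -
        obtain x where x: "x \<in> component d V z" "c v x = d" using hit z by blast
        have xS: "x \<notin> ?S" using x(1) z component_meet[of x d V y z] by blast
        have xV: "x \<in> V" using x z component_subset by blast
        have "c y x \<noteq> d" using component_closed[OF y(1) component_self xV] xS by blast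
        moreover have "v \<noteq> x" "v \<noteq> y" "x \<noteq> y"
          using xV y insert.hyps xS component_self[of y d V] by auto
        ultimately have "c x y = e"
          using no_rainbowD[OF insert.prems(1), of v x y] x y xV comm by auto
        then have "\<forall>y'\<in>?S. c x y' = e"
          using component_homogeneous[OF nrV y(1) component_self _ xV xS] by metis
        then show ?thesis using x by blast
      qed
      have VS: "c z y' = e" if z: "z \<in> V - ?S" and y': "y' \<in> ?S" for z y'
      proof -
        obtain x where x: "x \<in> component d V z" "\<forall>y'\<in>?S. c x y' = e" using out z by blast
        have "y' \<notin> component d V z" using component_meet[of y' d V y z] y' z by blast
        then have "c y' z = c y' x"
          using component_homogeneous[OF nrV _ component_self x(1)] z y' sub by blast
        then show ?thesis using x(2) y' comm by metis
      qed
      obtain z where z: "z \<in> V - ?S" using component_proper[OF d(2) y(1)] sub by blast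
      obtain x where x: "x \<in> component d V z" "c v x = d" "\<forall>y'\<in>?S. c x y' = e"
        using out z by blast
      have xV: "x \<in> V" using x z component_subset by blast
      have xS: "x \<notin> ?S" using component_meet[of x d V y z] x z by blast
      \<comment> \<open>The triangle \<open>v, x, y'\<close> already has \<open>d\<close> on
        \<open>v x\<close> and \<open>e\<close> on \<open>x y'\<close>.\<close>
      have vS: "c v y' \<in> {d, e}" if y': "y' \<in> ?S" for y'
      proof -
        have "v \<noteq> x" "v \<noteq> y'" "x \<noteq> y'" "y' \<in> V" using xV xS y' sub insert.hyps by auto
        then show ?thesis
          using no_rainbowD[OF insert.prems(1), of v x y'] x y' y(3) xV by auto
      qed
      have "c y' z' \<noteq> e'" if "y' \<in> ?S" "z' \<in> ?W - ?S" for y' z'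
      proof (cases "z' = v")
        case True
        then show ?thesis using vS[OF that(1)] e' comm[of y' v] by auto
      next
        case False
        then show ?thesis using VS[of z' y'] that e' comm[of y' z'] by auto
      qed
      then show ?thesis unfolding has_cut_def
        using sub insert.hyps component_self[of y d V] by (intro exI[of _ ?S]) auto
    qed
    have "\<exists>e. used e ?W \<and> e \<noteq> d" using insert.prems(2,3,5) by blast
    then obtain y where y: "y \<in> V" "c v y \<noteq> d" using star[of d] by blast
    \<comment> \<open>One of the three given colours differs from both \<open>d\<close> and
      \<open>c v y\<close>, and \<open>third\<close> disconnects it.\<close>
    have "\<exists>e'. used e' ?W \<and> e' \<noteq> d \<and> e' \<noteq> c v y"
      using insert.prems(2-) by (cases "d = d1"; cases "d = d2"; cases "c v y = d2"; cases "c v y = d1") blast+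
    then show False
      using third[OF y(1) refl y(2)] conn by blast
  qed
qed

text \<open>Gallai's theorem, with the partition encoded by a labelling \<open>f\<close> of the vertices. The
  induction contracts a component of a disconnected colour to a single vertex.\<close>

lemma gallai_partition:
  assumes "finite V" "no_rainbow V" "2 \<le> card V"
  shows "\<exists>(f :: 'a \<Rightarrow> 'a) R B. (\<exists>u\<in>V. \<exists>v\<in>V. f u \<noteq> f v) \<and>
    (\<forall>u\<in>V. \<forall>u'\<in>V. \<forall>v\<in>V. f u = f u' \<and> f u \<noteq> f v \<longrightarrow> c u v = c u' v \<and> c u v \<in> {R, B})"
  using assms
proof (induction "card V" arbitrary: V rule: less_induct)
  case less
  show ?case
  proof (cases "\<exists>d1 d2 d3. used d1 V \<and> used d2 V \<and> used d3 V \<and> d1 \<noteq> d2 \<and> d1 \<noteq> d3 \<and> d2 \<noteq> d3")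
    case True
    then obtain d where d: "used d V" "has_cut d V"
      using has_cut_of_three_colors[OF less.prems(1,2)] by metis
    then obtain x y where xy: "x \<in> V" "y \<in> V" "x \<noteq> y" "c x y = d" by (auto simp: used_def)
    define C where "C = component d V x"
    have C: "x \<in> C" "y \<in> C" "C \<subseteq> V" "C \<noteq> V"
      using xy component_self component_closed[OF xy(1) component_self xy(2,4)]
        component_subset component_proper d(2) by (auto simp: C_def)
    have hom: "c z u = c z x" if "u \<in> C" "z \<in> V" "z \<notin> C" for u z
      using component_homogeneous[OF less.prems(2) xy(1), of u d x z] that C by (auto simp: C_def)
    \<comment> \<open>Only \<open>x\<close> is kept from \<open>C\<close>. The edge
      \<open>x y\<close> inside \<open>C\<close> makes \<open>W\<close> smaller than
      \<open>V\<close>; a vertex outside \<open>C\<close> keeps two vertices in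
      \<open>W\<close>.\<close>
    define W where "W = insert x (V - C)"
    define h where "h v = (if v \<in> C then x else v)" for v
    have WV: "W \<subseteq> V" "y \<notin> W" using xy C by (auto simp: W_def)
    have "card W < card V" using WV xy less.prems(1) by (intro psubset_card_mono) auto
    moreover have "finite W" "no_rainbow W"
      using WV less.prems no_rainbow_subset finite_subset by blast+
    moreover have "2 \<le> card W"
    proof -
      obtain z where z: "z \<in> V - C" using C by blast
      then have "card {x, z} \<le> card W"
        using \<open>finite W\<close> by (intro card_mono) (auto simp: W_def)
      then show ?thesis using z C by (auto simp: card_insert_if split: if_splits)
    qed
    ultimately obtain f :: "'a \<Rightarrow> 'a" and R B where f: "\<exists>u\<in>W. \<exists>v\<in>W. f u \<noteq> f v"
      "\<forall>u\<in>W. \<forall>u'\<in>W. \<forall>v\<in>W. f u = f u' \<and> f u \<noteq> f v \<longrightarrow> c u v = c u' v \<and> c u v \<in> {R, B}"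
      using less.hyps[of W] by blast
    have hW: "h v \<in> W" if "v \<in> V" for v using that by (auto simp: h_def W_def)
    have hid: "h v = v" if "v \<in> W" for v using that by (auto simp: h_def W_def)
    \<comment> \<open>Edges between \<open>C\<close> and the outside keep their colour when the end
      in \<open>C\<close> is moved to \<open>x\<close>; other edges with
      \<open>h u \<noteq> h v\<close> do not move.\<close>
    have ch: "c u v = c (h u) (h v)" if "u \<in> V" "v \<in> V" "h u \<noteq> h v" for u v
      using that hom[of u v] hom[of v u] comm by (auto simp: h_def split: if_splits)
    have cols: "c u v = c u' v \<and> c u v \<in> {R, B}"
      if "u \<in> V" "u' \<in> V" "v \<in> V" "f (h u) = f (h u')" "f (h u) \<noteq> f (h v)" for u u' v
    proof -
      have "h u \<noteq> h v" "h u' \<noteq> h v" using that by auto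
      then show ?thesis using ch[of u v] ch[of u' v] f(2)[rule_format, OF hW hW hW, of u u' v] that by auto
    qed
    have nonconst: "\<exists>u\<in>V. \<exists>v\<in>V. f (h u) \<noteq> f (h v)" using f(1) hid WV(1) by (metis subsetD)
    have "\<forall>u\<in>V. \<forall>u'\<in>V. \<forall>v\<in>V. f (h u) = f (h u') \<and> f (h u) \<noteq> f (h v) \<longrightarrow>
        c u v = c u' v \<and> c u v \<in> {R, B}"
      using cols by blast
    with nonconst show ?thesis
      by - (rule exI[of _ "\<lambda>v. f (h v)"], rule exI[of _ R], rule exI[of _ B], rule conjI)
  next
    case False
    obtain u v where uv: "u \<in> V" "v \<in> V" "u \<noteq> v"
      using less.prems(3) card_le_Suc0_iff_eq[OF less.prems(1)] by force
    have "used (c u v) V" using uv by (auto simp: used_def)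
    \<comment> \<open>At most two colours are in use, so the singletons form the partition.\<close>
    then have "\<exists>R B. \<forall>d. used d V \<longrightarrow> d \<in> {R, B}" using False by (metis insert_iff)
    then obtain R B where RB: "\<And>d. used d V \<Longrightarrow> d \<in> {R, B}" by blast
    have "\<forall>u\<in>V. \<forall>v\<in>V. u \<noteq> v \<longrightarrow> c u v \<in> {R, B}"
      using RB unfolding used_def by blast
    with uv show ?thesis
      by - (rule exI[of _ "\<lambda>v. v"], rule exI[of _ R], rule exI[of _ B], auto)
  qed
qed

text \<open>Double counting from the side of \<open>v\<close>: an ordered pair on which
  \<open>v\<close> disagrees has one end among its \<open>R\<close>-neighbours and one among the
  others. Two numbers with sum \<open>card V - 1\<close> have product at most a quarter of its
  square; the 2 stands for the two orders.\<close>

lemma sum_disagreements_le: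
  assumes fin: "finite V" and two: "\<And>u v. u \<in> V \<Longrightarrow> v \<in> V \<Longrightarrow> u \<noteq> v \<Longrightarrow> c u v \<in> {R, B}"
  shows "(\<Sum>a\<in>V. \<Sum>b\<in>V. card {v \<in> V. v \<noteq> a \<and> v \<noteq> b \<and> c v a \<noteq> c v b})
     \<le> 2 * card V * ((card V - 1)\<^sup>2 div 4)"
proof -
  let ?D = "\<lambda>v a b. v \<noteq> a \<and> v \<noteq> b \<and> c v a \<noteq> c v b"
  have "(\<Sum>a\<in>V. \<Sum>b\<in>V. card {v \<in> V. ?D v a b}) = (\<Sum>a\<in>V. \<Sum>b\<in>V. \<Sum>v\<in>V. if ?D v a b then 1 else 0)"
    using fin by (simp add: sum.If_cases Int_def)
  also have "\<dots> = (\<Sum>a\<in>V. \<Sum>v\<in>V. \<Sum>b\<in>V. if ?D v a b then 1 else 0)"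
    by (intro sum.cong refl sum.swap)
  also have "\<dots> = (\<Sum>v\<in>V. \<Sum>a\<in>V. \<Sum>b\<in>V. if ?D v a b then 1 else 0)"
    by (rule sum.swap)
  also have "\<dots> \<le> (\<Sum>v\<in>V. 2 * ((card V - 1)\<^sup>2 div 4))"
  proof (intro sum_mono)
    fix v assume v: "v \<in> V"
    define P where "P = {a \<in> V - {v}. c v a = R}"
    define Q where "Q = {a \<in> V - {v}. c v a \<noteq> R}"
    have PQ: "finite P" "finite Q" "P \<inter> Q = {}" "P \<union> Q = V - {v}"
      using fin by (auto simp: P_def Q_def)
    have "card P + card Q = card (V - {v})"
      using card_Un_disjoint[OF PQ(1-3)] PQ(4) by simp
    then have pq: "card P + card Q = card V - 1" using v fin by simp
    have "(\<Sum>a\<in>V. \<Sum>b\<in>V. if ?D v a b then 1 else 0::nat)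
        = (\<Sum>a\<in>V. card {b \<in> V. ?D v a b})"
      using fin by (simp add: sum.If_cases Int_def)
    also have "\<dots> = card (SIGMA a:V. {b \<in> V. ?D v a b})"
      using fin by simp
    also have "\<dots> = card {(a, b) \<in> V \<times> V. ?D v a b}"
      by (intro arg_cong[where f = card]) auto
    also have "\<dots> \<le> card (P \<times> Q \<union> Q \<times> P)"
    proof (intro card_mono)
      show "{(a, b) \<in> V \<times> V. ?D v a b} \<subseteq> P \<times> Q \<union> Q \<times> P"
      proof (rule subrelI)
        fix a b assume "(a, b) \<in> {(a, b) \<in> V \<times> V. ?D v a b}"
        then have ab: "a \<in> V" "b \<in> V" "v \<noteq> a" "v \<noteq> b" "c v a \<noteq> c v b" by auto
        then show "(a, b) \<in> P \<times> Q \<union> Q \<times> P"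
          using two[OF v ab(1,3)] two[OF v ab(2,4)] by (auto simp: P_def Q_def)
      qed
    qed (use PQ in auto)
    also have "\<dots> \<le> 2 * (card P * card Q)"
      using card_Un_le[of "P \<times> Q" "Q \<times> P"] by (simp add: card_cartesian_product mult.commute)
    also have "\<dots> \<le> 2 * ((card V - 1)\<^sup>2 div 4)"
    proof -
      have "4 * (card P * card Q) \<le> (card P + card Q)\<^sup>2"
      proof -
        have "0 \<le> (int (card P) - int (card Q))\<^sup>2" by simp
        then have "4 * (int (card P) * int (card Q)) \<le> (int (card P) + int (card Q))\<^sup>2"
          by (simp add: power2_eq_square algebra_simps)
        then have "int (4 * (card P * card Q)) \<le> int ((card P + card Q)\<^sup>2)" by simp
        then show ?thesis by (simp only: of_nat_le_iff)
      qed
      then show ?thesis unfolding pq by (simp add: less_eq_div_iff_mult_less_eq mult.commute)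
    qed
    finally show "(\<Sum>a\<in>V. \<Sum>b\<in>V. if ?D v a b then 1 else 0) \<le> 2 * ((card V - 1)\<^sup>2 div 4)" .
  qed
  finally show ?thesis by (simp add: algebra_simps)
qed

end

section \<open>Few vertices that do not fit\<close>

text \<open>\<open>x, y, z\<close> are the colours from a vertex \<open>v\<close> to the small part \<open>a, b, d\<close> in the order of
  the list, and \<open>p, q\<close> the colours listed for \<open>a, b\<close>. The disjuncts correspond to placing \<open>v\<close>
  before \<open>a\<close>, between \<open>a\<close> and \<open>b\<close>, or after \<open>b\<close>; after \<open>b\<close> the last vertex imposes nothing, since
  \<open>v\<close> may precede it and take \<open>z\<close> as its own colour.\<close>

definition fits2 :: "'b \<Rightarrow> 'b \<Rightarrow> 'b \<Rightarrow> bool" where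
  "fits2 x y p \<longleftrightarrow> x = y \<or> x = p"

definition fits3 :: "'b \<Rightarrow> 'b \<Rightarrow> 'b \<Rightarrow> 'b \<Rightarrow> 'b \<Rightarrow> bool" where
  "fits3 x y z p q \<longleftrightarrow> x = y \<and> y = z \<or> x = p \<and> (y = z \<or> y = q)"

context sym_coloring
begin

definition bad2 :: "'a set \<Rightarrow> 'a \<Rightarrow> 'a \<Rightarrow> 'b \<Rightarrow> 'a set" where
  "bad2 V a b p = {v \<in> V - {a, b}. \<not> fits2 (c v a) (c v b) p}"

definition bad3 :: "'a set \<Rightarrow> 'a \<Rightarrow> 'a \<Rightarrow> 'a \<Rightarrow> 'b \<Rightarrow> 'b \<Rightarrow> 'a set" where
  "bad3 V a b d p q = {v \<in> V - {a, b, d}. \<not> fits3 (c v a) (c v b) (c v d) p q}"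

section \<open>Two vertices in the small part\<close>

lemma ex_few_bad2_two_colors:
  assumes fin: "finite V" and M: "2 \<le> card V"
    and two: "\<And>u v. u \<in> V \<Longrightarrow> v \<in> V \<Longrightarrow> u \<noteq> v \<Longrightarrow> c u v \<in> {R, B}"
  shows "\<exists>a\<in>V. \<exists>b\<in>V. \<exists>p. a \<noteq> b \<and> 4 * card (bad2 V a b p) \<le> card V - 1"
proof (rule ccontr)
  assume no: "\<not> ?thesis"
  define M where "M = card V"
  define X where "X a b = card {v \<in> V. v \<noteq> a \<and> v \<noteq> b \<and> c v a \<noteq> c v b}" for a b
  have lb: "2 * M \<le> 4 * X a b" if ab: "a \<in> V" "b \<in> V" "a \<noteq> b" for a b
  proof -
    have big: "M \<le> 4 * card (bad2 V a b p)" for p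
    proof -
      have "\<not> 4 * card (bad2 V a b p) \<le> card V - 1" using no ab by blast
      then show ?thesis by (simp add: M_def)
    qed
    \<comment> \<open>A disagreeing vertex is bad for only one of the guesses \<open>p = R\<close>
      and \<open>p = B\<close>.\<close>
    have "card (bad2 V a b R) + card (bad2 V a b B) \<le> X a b"
    proof -
      have "bad2 V a b R \<inter> bad2 V a b B = {}"
        using two ab by (force simp: bad2_def fits2_def)
      then have "card (bad2 V a b R) + card (bad2 V a b B) = card (bad2 V a b R \<union> bad2 V a b B)"
        using fin by (intro card_Un_disjoint[symmetric]) (auto simp: bad2_def)
      also have "\<dots> \<le> X a b"
        unfolding X_def using fin by (intro card_mono) (auto simp: bad2_def fits2_def)
      finally show ?thesis .
    qed
    then show ?thesis using big[of R] big[of B] by linarith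
  qed
  have "M * (M - 1) * (2 * M) = (\<Sum>a\<in>V. \<Sum>b\<in>V - {a}. 2 * M)"
    using fin by (simp add: M_def)
  also have "\<dots> \<le> (\<Sum>a\<in>V. \<Sum>b\<in>V - {a}. 4 * X a b)"
    using lb by (intro sum_mono) auto
  also have "\<dots> \<le> (\<Sum>a\<in>V. \<Sum>b\<in>V. 4 * X a b)"
    using fin by (intro sum_mono sum_mono2) auto
  also have "\<dots> = 4 * (\<Sum>a\<in>V. \<Sum>b\<in>V. X a b)"
    by (simp add: sum_distrib_left)
  also have "\<dots> \<le> 4 * (2 * M * ((M - 1)\<^sup>2 div 4))"
    using sum_disagreements_le[OF fin two] unfolding X_def M_def by simp
  also have "\<dots> \<le> 2 * M * (M - 1)\<^sup>2"
  proof -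
    have "4 * ((M - 1)\<^sup>2 div 4) \<le> (M - 1)\<^sup>2" by simp
    then have "2 * M * (4 * ((M - 1)\<^sup>2 div 4)) \<le> 2 * M * (M - 1)\<^sup>2" by (rule mult_le_mono2)
    then show ?thesis by (simp only: ac_simps)
  qed
  \<comment> \<open>Cancelling the common factor leaves \<open>M \<le> M - 1\<close>.\<close>
  finally have "(2 * M * (M - 1)) * M \<le> (2 * M * (M - 1)) * (M - 1)"
    by (simp only: power2_eq_square ac_simps)
  then show False using M by (simp add: M_def)
qed

text \<open>Induction through the classes of a Gallai partition. If all are singletons, only
  \<open>R\<close> and \<open>B\<close> occur; otherwise some class has two vertices, and since the
  bound grows with the number of vertices, a pair good inside the class is good in
  \<open>V\<close>.\<close>

lemma ex_few_bad2:
  assumes "finite V" "no_rainbow V" "2 \<le> card V"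
  shows "\<exists>a\<in>V. \<exists>b\<in>V. \<exists>p. a \<noteq> b \<and> 4 * card (bad2 V a b p) \<le> card V - 1"
  using assms
proof (induction "card V" arbitrary: V rule: less_induct)
  case less
  from gallai_partition[OF less.prems] obtain f :: "'a \<Rightarrow> 'a" and R B where
    f1: "\<exists>u\<in>V. \<exists>v\<in>V. f u \<noteq> f v" and
    "\<forall>u\<in>V. \<forall>u'\<in>V. \<forall>v\<in>V. f u = f u' \<and> f u \<noteq> f v \<longrightarrow> c u v = c u' v \<and> c u v \<in> {R, B}"
    by (elim exE conjE)
  then have f2: "c u v = c u' v \<and> c u v \<in> {R, B}"
    if "u \<in> V" "u' \<in> V" "v \<in> V" "f u = f u'" "f u \<noteq> f v" for u u' v
    using that by blast
  show ?case
  proof (cases "inj_on f V")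
    case True
    then show ?thesis
      using f2 by (intro ex_few_bad2_two_colors[OF less.prems(1,3), of R B]) (auto dest: inj_onD)
  next
    case False
    then obtain x y where xy: "x \<in> V" "y \<in> V" "x \<noteq> y" "f x = f y" by (auto simp: inj_on_def)
    define A where "A = {v \<in> V. f v = f x}"
    have "\<exists>v\<in>V. f v \<noteq> f x" using f1 by metis
    then have AV: "A \<subset> V" by (auto simp: A_def)
    have fA: "finite A" using AV less.prems(1) finite_subset by blast
    have "card {x, y} \<le> card A" using fA xy by (intro card_mono) (auto simp: A_def)
    then have "2 \<le> card A" using xy by simp
    moreover have lt: "card A < card V" using AV less.prems(1) by (rule psubset_card_mono[rotated])
    moreover have "no_rainbow A" using AV less.prems(2) no_rainbow_subset by blast
    ultimately obtain a b p where abp: "a \<in> A" "b \<in> A" "a \<noteq> b" "4 * card (bad2 A a b p) \<le> card A - 1"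
      using less.hyps[of A] fA by blast
    \<comment> \<open>A vertex outside the class sends one colour to both \<open>a\<close> and
      \<open>b\<close>, so it fits for every \<open>p\<close>.\<close>
    have "bad2 V a b p \<subseteq> bad2 A a b p"
    proof
      fix v assume v: "v \<in> bad2 V a b p"
      then have "c a v \<noteq> c b v" "v \<in> V" using comm by (auto simp: bad2_def fits2_def)
      then have "f a = f v" using f2[of a b v] abp by (auto simp: A_def)
      then have "v \<in> A" using abp(1) \<open>v \<in> V\<close> by (simp add: A_def)
      then show "v \<in> bad2 A a b p" using v by (auto simp: bad2_def)
    qed
    then have "card (bad2 V a b p) \<le> card (bad2 A a b p)"
      using fA by (intro card_mono) (auto simp: bad2_def)
    then have "4 * card (bad2 V a b p) \<le> card V - 1" using abp(4) lt by linarith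
    then show ?thesis using abp AV by blast
  qed
qed

section \<open>Three vertices in the small part\<close>

text \<open>The colours \<open>p\<close> and \<open>q\<close> are averaged over \<open>R\<close> and \<open>B\<close>, the triple over all ordered
  triples.\<close>

lemma ex_few_bad3_two_colors:
  assumes fin: "finite V" and V3: "3 \<le> card V"
    and two: "\<And>u v. u \<in> V \<Longrightarrow> v \<in> V \<Longrightarrow> u \<noteq> v \<Longrightarrow> c u v \<in> {R, B}"
  shows "\<exists>a\<in>V. \<exists>b\<in>V. \<exists>d\<in>V. \<exists>p q. a \<noteq> b \<and> a \<noteq> d \<and> b \<noteq> d \<and>
    card (bad3 V a b d p q) \<le> (card V - 3) div 2"
proof (rule ccontr)
  assume no: "\<not> ?thesis"
  define M where "M = card V"
  \<comment> \<open>One more than \<open>(M - 3) div 2\<close>: by the negated goal every choice has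
    at least \<open>m\<close> bad vertices.\<close>
  define m where "m = (M - 1) div 2"
  define X where "X a b = {v \<in> V. v \<noteq> a \<and> v \<noteq> b \<and> c v a \<noteq> c v b}" for a b
  define D where "D a b d \<longleftrightarrow> a \<noteq> b \<and> a \<noteq> d \<and> b \<noteq> d" for a b d :: 'a
  define F where "F a b d = (if D a b d then card (X a b - {d}) else 0)" for a b d
  have M3: "3 \<le> M" using V3 by (simp add: M_def)
  have card_sum: "card {v \<in> V. P v} = (\<Sum>v\<in>V. if P v then 1 else 0)" for P
    using fin by (simp add: sum.If_cases Int_def)
  \<comment> \<open>The weights 1, 1, 2 come from the four pairs \<open>(p, q)\<close>. A vertex is
    bad for none of them if its three colours agree, for two if the colour to \<open>a\<close> is
    the odd one, and for three if the colour to \<open>b\<close> or to \<open>d\<close> is.\<close>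
  have lb: "(if D a b d then 4 * m else 0) \<le> F a b d + F a d b + 2 * F b d a"
    if V: "a \<in> V" "b \<in> V" "d \<in> V" for a b d
  proof (cases "D a b d")
    case True
    have big: "m \<le> card (bad3 V a b d p q)" for p q
    proof -
      have "\<not> card (bad3 V a b d p q) \<le> (M - 3) div 2"
        using no V True unfolding M_def D_def by blast
      then show ?thesis using M3 by (simp add: m_def)
    qed
    have b3: "bad3 V a b d p q = {v \<in> V. v \<notin> {a, b, d} \<and> \<not> fits3 (c v a) (c v b) (c v d) p q}" for p q
      by (auto simp: bad3_def)
    have Xd: "X a b - {d} = {v \<in> V. v \<notin> {a, b, d} \<and> c v a \<noteq> c v b}"
      "X a d - {b} = {v \<in> V. v \<notin> {a, b, d} \<and> c v a \<noteq> c v d}"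
      "X b d - {a} = {v \<in> V. v \<notin> {a, b, d} \<and> c v b \<noteq> c v d}" by (auto simp: X_def)
    have "card (bad3 V a b d R R) + card (bad3 V a b d R B)
        + card (bad3 V a b d B R) + card (bad3 V a b d B B)
      \<le> card (X a b - {d}) + card (X a d - {b}) + 2 * card (X b d - {a})"
      unfolding b3 Xd card_sum sum_distrib_left sum.distrib[symmetric]
    proof (intro sum_mono)
      fix v assume v: "v \<in> V"
      show "(if v \<notin> {a, b, d} \<and> \<not> fits3 (c v a) (c v b) (c v d) R R then 1 else 0)
          + (if v \<notin> {a, b, d} \<and> \<not> fits3 (c v a) (c v b) (c v d) R B then 1 else 0)
          + (if v \<notin> {a, b, d} \<and> \<not> fits3 (c v a) (c v b) (c v d) B R then 1 else 0)
          + (if v \<notin> {a, b, d} \<and> \<not> fits3 (c v a) (c v b) (c v d) B B then 1 else 0)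
        \<le> (if v \<notin> {a, b, d} \<and> c v a \<noteq> c v b then 1 else 0)
          + (if v \<notin> {a, b, d} \<and> c v a \<noteq> c v d then 1 else 0)
          + 2 * (if v \<notin> {a, b, d} \<and> c v b \<noteq> c v d then 1 else (0::nat))"
      proof (cases "v \<in> {a, b, d}")
        case False
        then have vc: "c v a \<in> {R, B}" "c v b \<in> {R, B}" "c v d \<in> {R, B}"
          using two v V by auto
        have "(if \<not> fits3 x y z R R then 1 else 0) + (if \<not> fits3 x y z R B then 1 else 0)
            + (if \<not> fits3 x y z B R then 1 else 0) + (if \<not> fits3 x y z B B then 1 else 0)
          \<le> (if x \<noteq> y then 1 else 0) + (if x \<noteq> z then 1 else 0) + 2 * (if y \<noteq> z then 1 else (0::nat))"
          if "x \<in> {R, B}" "y \<in> {R, B}" "z \<in> {R, B}" for x y z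
          using that by (cases "x = R"; cases "y = R"; cases "z = R") (simp_all add: fits3_def)
        from this[OF vc] False show ?thesis by (simp only: simp_thms)
      qed auto
    qed
    then show ?thesis
      using True big[of R R] big[of R B] big[of B R] big[of B B] by (auto simp: F_def D_def)
  qed simp
  let ?S = "\<Sum>a\<in>V. \<Sum>b\<in>V. \<Sum>d\<in>V. F a b d"
  have "(\<Sum>a\<in>V. \<Sum>b\<in>V. \<Sum>d\<in>V. if D a b d then 4 * m else 0) = M * ((M - 1) * ((M - 2) * (4 * m)))"
  proof -
    have "(\<Sum>d\<in>V. if D a b d then 4 * m else 0) = (if a \<noteq> b then (M - 2) * (4 * m) else 0)"
      if "a \<in> V" "b \<in> V" for a b
    proof -
      have "{d \<in> V. D a b d} = (if a \<noteq> b then V - {a, b} else {})" by (auto simp: D_def)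
      then show ?thesis using that fin by (simp add: sum.If_cases Int_def M_def numeral_2_eq_2)
    qed
    moreover have "(\<Sum>b\<in>V. if a \<noteq> b then k else 0) = (M - 1) * k" if "a \<in> V" for a and k :: nat
    proof -
      have "{b \<in> V. a \<noteq> b} = V - {a}" by auto
      then show ?thesis using that fin by (simp add: sum.If_cases Int_def M_def)
    qed
    ultimately show ?thesis by (simp add: M_def)
  qed
  then have "M * ((M - 1) * ((M - 2) * (4 * m)))
      \<le> (\<Sum>a\<in>V. \<Sum>b\<in>V. \<Sum>d\<in>V. F a b d + F a d b + 2 * F b d a)"
    using lb by (metis (no_types, lifting) sum_mono)
  also have "\<dots> = ?S + (\<Sum>a\<in>V. \<Sum>b\<in>V. \<Sum>d\<in>V. F a d b) + 2 * (\<Sum>a\<in>V. \<Sum>b\<in>V. \<Sum>d\<in>V. F b d a)"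
    by (simp add: sum.distrib sum_distrib_left)
  \<comment> \<open>Summing over all ordered triples makes the three terms reindexings of one sum,
    with total weight 1 + 1 + 2 = 4.\<close>
  also have "(\<Sum>a\<in>V. \<Sum>b\<in>V. \<Sum>d\<in>V. F a d b) = ?S"
    by (intro sum.cong refl sum.swap)
  also have "(\<Sum>a\<in>V. \<Sum>b\<in>V. \<Sum>d\<in>V. F b d a) = (\<Sum>b\<in>V. \<Sum>a\<in>V. \<Sum>d\<in>V. F b d a)"
    by (rule sum.swap)
  also have "\<dots> = ?S"
    by (intro sum.cong refl sum.swap)
  also have "?S + ?S + 2 * ?S = 4 * ?S" by simp
  \<comment> \<open>A vertex \<open>v\<close> of \<open>X a b\<close> is counted once for each
    \<open>d\<close> outside \<open>{a, b, v}\<close>.\<close>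
  also have "?S \<le> (\<Sum>a\<in>V. \<Sum>b\<in>V. (M - 3) * card (X a b))"
  proof (intro sum_mono)
    fix a b assume ab: "a \<in> V" "b \<in> V"
    show "(\<Sum>d\<in>V. F a b d) \<le> (M - 3) * card (X a b)"
    proof (cases "a = b")
      case False
      have fX: "finite (X a b)" using fin by (simp add: X_def)
      have "(\<Sum>d\<in>V. F a b d) = (\<Sum>d\<in>V. \<Sum>v\<in>X a b. if D a b d \<and> v \<noteq> d then 1 else 0)"
      proof (intro sum.cong refl)
        fix d
        have "X a b - {d} = {v \<in> X a b. v \<noteq> d}" by auto
        then show "F a b d = (\<Sum>v\<in>X a b. if D a b d \<and> v \<noteq> d then 1 else 0)"
          using fX by (simp add: F_def sum.If_cases Int_def)
      qed
      also have "\<dots> = (\<Sum>v\<in>X a b. \<Sum>d\<in>V. if D a b d \<and> v \<noteq> d then 1 else 0)"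
        by (rule sum.swap)
      also have "\<dots> = (\<Sum>v\<in>X a b. M - 3)"
      proof (intro sum.cong refl)
        fix v assume v: "v \<in> X a b"
        have "(\<Sum>d\<in>V. if D a b d \<and> v \<noteq> d then 1 else 0) = card {d \<in> V. D a b d \<and> v \<noteq> d}"
          by (simp only: card_sum)
        also have "{d \<in> V. D a b d \<and> v \<noteq> d} = V - {a, b, v}"
          using False by (auto simp: D_def)
        also have "card \<dots> = M - card {a, b, v}"
          using ab v fin by (subst card_Diff_subset) (auto simp: X_def M_def)
        also have "card {a, b, v} = 3" using False v by (auto simp: X_def card_insert_if)
        finally show "(\<Sum>d\<in>V. if D a b d \<and> v \<noteq> d then 1 else 0) = M - 3" .
      qed
      finally show ?thesis by simp
    qed (simp add: F_def D_def)
  qed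
  also have "\<dots> = (M - 3) * (\<Sum>a\<in>V. \<Sum>b\<in>V. card (X a b))"
    by (simp add: sum_distrib_left)
  also have "\<dots> \<le> (M - 3) * (2 * M * ((M - 1)\<^sup>2 div 4))"
    using sum_disagreements_le[OF fin two] unfolding X_def M_def by simp
  finally have ineq: "M * ((M - 1) * ((M - 2) * (4 * m))) \<le> 4 * ((M - 3) * (2 * M * ((M - 1)\<^sup>2 div 4)))"
    by simp
  show False
  proof (cases "even M")
    case True
    \<comment> \<open>The shift removes truncated subtraction. Cancelling
      \<open>8 * (2 * k + 4) * (k + 1)\<close> leaves
      \<open>(2 * k + 3) * (k + 1) \<le> (2 * k + 1) * (k + 2)\<close>, which fails by 1.\<close>
    define k where "k = M div 2 - 2"
    have Mk: "M = 2 * k + 4" using True M3 by (auto simp: k_def)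
    have Mi: "M - 1 = 2 * k + 3" "M - 2 = 2 * k + 2" "M - 3 = 2 * k + 1" by (simp_all add: Mk)
    have sq: "(M - 1)\<^sup>2 div 4 = (k + 1) * (k + 2)"
    proof -
      have "(M - 1)\<^sup>2 = 4 * ((k + 1) * (k + 2)) + 1"
        by (simp add: Mk power2_eq_square algebra_simps)
      then show ?thesis by simp
    qed
    have m: "m = k + 1" by (simp add: m_def Mk)
    have "(2 * k + 4) * ((2 * k + 3) * ((2 * k + 2) * (4 * (k + 1))))
        \<le> 4 * ((2 * k + 1) * (2 * (2 * k + 4) * ((k + 1) * (k + 2))))"
      using ineq unfolding sq m unfolding Mi unfolding Mk .
    then show False by (simp add: algebra_simps)
  next
    case False
    \<comment> \<open>Here cancelling \<open>8 * (2 * k + 3) * (k + 1) * (k + 1)\<close> leaves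
      \<open>2 * k + 1 \<le> 2 * k\<close>.\<close>
    define k where "k = M div 2 - 1"
    have Mk: "M = 2 * k + 3" using False M3 by (auto simp: k_def elim!: oddE)
    have Mi: "M - 1 = 2 * k + 2" "M - 2 = 2 * k + 1" "M - 3 = 2 * k" by (simp_all add: Mk)
    have sq: "(M - 1)\<^sup>2 div 4 = (k + 1) * (k + 1)"
    proof -
      have "(M - 1)\<^sup>2 = 4 * ((k + 1) * (k + 1))"
        by (simp add: Mk power2_eq_square algebra_simps)
      then show ?thesis by simp
    qed
    have m: "m = k + 1" by (simp add: m_def Mk)
    have "(2 * k + 3) * ((2 * k + 2) * ((2 * k + 1) * (4 * (k + 1))))
        \<le> 4 * ((2 * k) * (2 * (2 * k + 3) * ((k + 1) * (k + 1))))"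
      using ineq unfolding sq m unfolding Mi unfolding Mk .
    then show False by (simp add: algebra_simps)
  qed
qed

text \<open>The induction for two vertices carries over to classes with at least three vertices. A
  class of exactly two vertices holds no triple, but its members receive equal colours from every
  outside vertex, and a third vertex is taken from outside.\<close>

lemma ex_few_bad3:
  assumes "finite V" "no_rainbow V" "3 \<le> card V"
  shows "\<exists>a\<in>V. \<exists>b\<in>V. \<exists>d\<in>V. \<exists>p q. a \<noteq> b \<and> a \<noteq> d \<and> b \<noteq> d \<and>
    card (bad3 V a b d p q) \<le> (card V - 3) div 2"
  using assms
proof (induction "card V" arbitrary: V rule: less_induct)
  case less
  have V2: "2 \<le> card V" using less.prems(3) by simp
  from gallai_partition[OF less.prems(1,2) V2] obtain f :: "'a \<Rightarrow> 'a" and R B where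
    f1: "\<exists>u\<in>V. \<exists>v\<in>V. f u \<noteq> f v" and
    "\<forall>u\<in>V. \<forall>u'\<in>V. \<forall>v\<in>V. f u = f u' \<and> f u \<noteq> f v \<longrightarrow> c u v = c u' v \<and> c u v \<in> {R, B}"
    by (elim exE conjE)
  then have f2: "c u v = c u' v \<and> c u v \<in> {R, B}"
    if "u \<in> V" "u' \<in> V" "v \<in> V" "f u = f u'" "f u \<noteq> f v" for u u' v
    using that by blast
  define A where "A x = {v \<in> V. f v = f x}" for x
  have "\<exists>v\<in>V. f v \<noteq> f x" for x using f1 by metis
  then have AV: "A x \<subset> V" for x by (auto simp: A_def psubset_eq)
  have fA: "finite (A x)" for x using AV[of x] less.prems(1) finite_subset by blast
  show ?case
  proof (cases "inj_on f V")
    case True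
    then show ?thesis
      using f2 by (intro ex_few_bad3_two_colors[OF less.prems(1,3), of R B]) (auto dest: inj_onD)
  next
    case False
    then obtain x y where xy: "x \<in> V" "y \<in> V" "x \<noteq> y" "f x = f y" by (auto simp: inj_on_def)
    have xyA: "{x, y} \<subseteq> A x" using xy by (auto simp: A_def)
    show ?thesis
    proof (cases "3 \<le> card (A x)")
      case True
      have lt: "card (A x) < card V" using AV less.prems(1) by (rule psubset_card_mono[rotated])
      have "no_rainbow (A x)" using AV less.prems(2) no_rainbow_subset by blast
      then obtain a b d p q where abd: "a \<in> A x" "b \<in> A x" "d \<in> A x" "a \<noteq> b" "a \<noteq> d" "b \<noteq> d"
        "card (bad3 (A x) a b d p q) \<le> (card (A x) - 3) div 2"
        using less.hyps[OF lt fA] True by blast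
      have "bad3 V a b d p q \<subseteq> bad3 (A x) a b d p q"
      proof
        fix v assume v: "v \<in> bad3 V a b d p q"
        then have "c a v \<noteq> c b v \<or> c b v \<noteq> c d v" "v \<in> V"
          using comm by (auto simp: bad3_def fits3_def)
        then have "f a = f v" using f2[of a b v] f2[of b d v] abd
          by (cases "f x = f v") (auto simp: A_def)
        then have "v \<in> A x" using abd(1) \<open>v \<in> V\<close> by (simp add: A_def)
        then show "v \<in> bad3 (A x) a b d p q" using v by (auto simp: bad3_def)
      qed
      then have "card (bad3 V a b d p q) \<le> card (bad3 (A x) a b d p q)"
        using fA by (intro card_mono) (auto simp: bad3_def)
      also have "\<dots> \<le> (card V - 3) div 2" using abd(7) lt by simp
      finally show ?thesis using abd AV by blast
    next
      case False
      have "card (A x) \<le> card {x, y}" using False xy by simp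
      then have Axy: "A x = {x, y}" using card_seteq[OF fA xyA] by simp
      have out: "c v x = c v y" "c v x \<in> {R, B}" if "v \<in> V - {x, y}" for v
      proof -
        have "f v \<noteq> f x" using that Axy by (auto simp: A_def)
        then show "c v x = c v y" "c v x \<in> {R, B}" using f2[of x y v] xy that comm by auto
      qed
      \<comment> \<open>Here \<open>x\<close> sees at most two colours outside the class, and \<open>p\<close> is the more frequent one. In
        the triple \<open>x, y, z\<close> only vertices of the other colour can fail to fit, and \<open>z\<close> is chosen
        among these.\<close>
      define W where "W = V - {x, y}"
      have W: "finite W" "card W = card V - 2" using less.prems(1) xy by (auto simp: W_def)
      have "\<exists>p. 2 * card {v \<in> W. c v x \<noteq> p} \<le> card W"
      proof (cases "R = B")
        case True
        then have "{v \<in> W. c v x \<noteq> R} = {}" using out by (auto simp: W_def)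
        then have "2 * card {v \<in> W. c v x \<noteq> R} \<le> card W" by (simp only: card.empty)
        then show ?thesis by blast
      next
        case False
        have "{v \<in> W. c v x \<noteq> R} \<inter> {v \<in> W. c v x \<noteq> B} = {}" using out by (auto simp: W_def)
        then have "card {v \<in> W. c v x \<noteq> R} + card {v \<in> W. c v x \<noteq> B}
            = card ({v \<in> W. c v x \<noteq> R} \<union> {v \<in> W. c v x \<noteq> B})"
          using W by (intro card_Un_disjoint[symmetric]) auto
        also have "\<dots> \<le> card W" using W by (intro card_mono) auto
        finally have "2 * card {v \<in> W. c v x \<noteq> R} \<le> card W \<or> 2 * card {v \<in> W. c v x \<noteq> B} \<le> card W"
          by linarith
        then show ?thesis by blast
      qed
      then obtain p where p: "2 * card {v \<in> W. c v x \<noteq> p} \<le> card W" by blast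
      have "\<exists>z\<in>W. card ({v \<in> W. c v x \<noteq> p} - {z}) \<le> (card V - 3) div 2"
      proof (cases "{v \<in> W. c v x \<noteq> p} = {}")
        case True
        have "W \<noteq> {}" using W less.prems(3) by auto
        then show ?thesis unfolding True by auto
      next
        case False
        then obtain z where z: "z \<in> W" "c z x \<noteq> p" by blast
        then have "card ({v \<in> W. c v x \<noteq> p} - {z}) = card {v \<in> W. c v x \<noteq> p} - 1" by simp
        \<comment> \<open>For even \<open>card V\<close>, half of \<open>card V - 2\<close> exceeds
          \<open>(card V - 3) div 2\<close> by exactly one; moving \<open>z\<close> into the small
          part makes up for it.\<close>
        also have "\<dots> \<le> (card V - 3) div 2" using p W by linarith
        finally show ?thesis using z by blast
      qed
      then obtain z where z: "z \<in> W" "card ({v \<in> W. c v x \<noteq> p} - {z}) \<le> (card V - 3) div 2" by blast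
      \<comment> \<open>\<open>x\<close> and \<open>y\<close> get the same colour from
        \<open>v\<close>, so \<open>v\<close> fits as soon as that colour is
        \<open>p\<close>.\<close>
      have "bad3 V x y z p p \<subseteq> {v \<in> W. c v x \<noteq> p} - {z}"
        using out by (auto simp: bad3_def fits3_def W_def)
      then have "card (bad3 V x y z p p) \<le> card ({v \<in> W. c v x \<noteq> p} - {z})"
        using W by (intro card_mono) auto
      then have "card (bad3 V x y z p p) \<le> (card V - 3) div 2" using z(2) by linarith
      moreover have "z \<in> V" "x \<noteq> z" "y \<noteq> z" using z(1) by (auto simp: W_def)
      ultimately show ?thesis using xy by blast
    qed
  qed
qed

end

section \<open>Orderable copies of complete bipartite graphs\<close>

lemma orderableI:
  fixes pos :: "'a \<Rightarrow> nat"
  assumes fin: "finite (verts G)"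
    and col: "\<And>x y. x \<in> verts G \<Longrightarrow> y \<in> verts G \<Longrightarrow> {x, y} \<in> edges G \<Longrightarrow> pos x \<le> pos y \<Longrightarrow>
      \<chi> {x, y} = col x"
  shows "orderable G \<chi>"
proof -
  obtain xs where xs: "set xs = verts G" "distinct xs" using finite_distinct_list[OF fin] by blast
  \<comment> \<open>Ties of \<open>pos\<close> are broken arbitrarily, which is why
    \<open>col\<close> is assumed correct under \<open>pos x \<le> pos y\<close>.\<close>
  define vs where "vs = sort_key pos xs"
  have vs: "set vs = verts G" "distinct vs" "sorted (map pos vs)"
    using xs by (simp_all add: vs_def)
  have len: "length vs = card (verts G)" using vs distinct_card by metis
  \<comment> \<open>The last vertex has no later neighbour; \<open>butlast\<close> gives the
    required length \<open>card (verts G) - 1\<close>.\<close>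
  have "\<chi> {vs ! i, vs ! j} = map col (butlast vs) ! i"
    if "i < j" "j < card (verts G)" "{vs ! i, vs ! j} \<in> edges G" for i j
  proof -
    have "pos (vs ! i) \<le> pos (vs ! j)"
      using sorted_nth_mono[OF vs(3), of i j] that len by simp
    moreover have "map col (butlast vs) ! i = col (vs ! i)"
      using that len by (simp add: nth_butlast)
    moreover have "vs ! i \<in> verts G" "vs ! j \<in> verts G"
      using that len vs(1) nth_mem by (metis less_trans)+
    ultimately show ?thesis using col that(3) by simp
  qed
  then show ?thesis unfolding orderable_def using vs len
    by (intro exI[of _ vs] exI[of _ "map col (butlast vs)"]) auto
qed

lemma orderableE:
  assumes "orderable G \<chi>"
  obtains pos :: "'a \<Rightarrow> nat" and col where "inj_on pos (verts G)"
    "\<forall>x\<in>verts G. \<forall>y\<in>verts G. {x, y} \<in> edges G \<and> pos x < pos y \<longrightarrow> \<chi> {x, y} = col x"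
proof -
  obtain vs cs where vs: "distinct vs" "set vs = verts G"
    and cs: "\<forall>i j. i < j \<and> j < card (verts G) \<and> {vs ! i, vs ! j} \<in> edges G \<longrightarrow>
           \<chi> {vs ! i, vs ! j} = cs ! i"
    using assms unfolding orderable_def by blast
  have len: "length vs = card (verts G)" using vs distinct_card by metis
  define pos where "pos = inv_into {..<length vs} (nth vs)"
  have bij: "bij_betw (nth vs) {..<length vs} (verts G)"
    using vs by (intro bij_betw_nth) auto
  have pos: "pos x < length vs" "vs ! pos x = x" if "x \<in> verts G" for x
    using that bij inv_into_into[of x "nth vs" "{..<length vs}"]
    by (auto simp: pos_def bij_betw_def f_inv_into_f)
  have "inj_on pos (verts G)" using pos by (metis inj_onI)
  moreover have "\<forall>x\<in>verts G. \<forall>y\<in>verts G. {x, y} \<in> edges G \<and> pos x < pos y \<longrightarrow>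
      \<chi> {x, y} = cs ! pos x"
    using pos cs len by metis
  ultimately show thesis using that[of pos "\<lambda>x. cs ! pos x"] by blast
qed

section \<open>Copies of complete bipartite graphs\<close>

lemma copy_complete_bipartiteE:
  assumes "copy_of_in C (complete_bipartite s t) H"
  obtains A T where "verts C = A \<union> T" "A \<union> T \<subseteq> verts H" "A \<inter> T = {}" "card A = s" "card T = t"
    "edges C = {{a, v} | a v. a \<in> A \<and> v \<in> T}"
proof -
  obtain f where f: "bij_betw f {..<s + t} (verts C)"
    and E: "edges C = (\<lambda>e. f ` e) ` {{i, j} | i j. i < s \<and> s \<le> j \<and> j < s + t}"
    and sub: "verts C \<subseteq> verts H"
    using assms unfolding copy_of_in_def isomorphic_def subgraph_of_def complete_bipartite_def
    by auto
  let ?A = "f ` {..<s}" and ?T = "f ` {s..<s + t}"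
  have inj: "inj_on f {..<s + t}" using f by (simp add: bij_betw_def)
  have un: "{..<s + t} = {..<s} \<union> {s..<s + t}" by auto
  have V: "verts C = ?A \<union> ?T"
    using f unfolding bij_betw_def un image_Un by simp
  have "?A \<inter> ?T = f ` ({..<s} \<inter> {s..<s + t})"
    using inj by (intro inj_on_image_Int[symmetric]) auto
  then have "?A \<inter> ?T = {}" by auto
  moreover have "card ?A = s" "card ?T = t"
    using inj_on_subset[OF inj[unfolded un]] by (auto simp: card_image)
  moreover have "edges C = {{a, v} | a v. a \<in> ?A \<and> v \<in> ?T}"
  proof (intro set_eqI iffI)
    fix e assume "e \<in> edges C"
    then obtain i j where "e = {f i, f j}" "i < s" "s \<le> j" "j < s + t" by (auto simp: E)
    then show "e \<in> {{a, v} | a v. a \<in> ?A \<and> v \<in> ?T}" by force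
  next
    fix e assume "e \<in> {{a, v} | a v. a \<in> ?A \<and> v \<in> ?T}"
    then obtain i j where ij: "e = {f i, f j}" "i < s" "s \<le> j" "j < s + t" by auto
    then have "e = f ` {i, j}" by simp
    then show "e \<in> edges C" unfolding E using ij by blast
  qed
  ultimately show thesis using that[of ?A ?T] V sub by auto
qed

lemma copy_complete_bipartiteI:
  assumes "A \<union> T \<subseteq> {..<n}" "A \<inter> T = {}" "card A = s" "card T = t"
  shows "copy_of_in \<lparr>verts = A \<union> T, edges = {{a, v} | a v. a \<in> A \<and> v \<in> T}\<rparr>
    (complete_bipartite s t) (complete_graph n)"
proof -
  have fin: "finite A" "finite T" using assms(1) finite_subset by auto
  obtain h1 where h1: "bij_betw h1 {..<s} A"
    using ex_bij_betw_nat_finite[OF fin(1)] assms(3) by (auto simp: atLeast0LessThan)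
  obtain h2 where h2: "bij_betw h2 {s..<s + t} T"
    using finite_same_card_bij[of "{s..<s + t}" T] fin(2) assms(4) by auto
  define f where "f i = (if i < s then h1 i else h2 i)" for i
  have f1: "bij_betw f {..<s} A" using h1 by (subst bij_betw_cong[of _ f h1]) (auto simp: f_def)
  have f2: "bij_betw f {s..<s + t} T" using h2 by (subst bij_betw_cong[of _ f h2]) (auto simp: f_def)
  have un: "{..<s + t} = {..<s} \<union> {s..<s + t}" by auto
  have f: "bij_betw f {..<s + t} (A \<union> T)"
    unfolding un using f1 f2 assms(2) by (intro bij_betw_combine)
  have "{{a, v} | a v. a \<in> A \<and> v \<in> T}
      = (\<lambda>e. f ` e) ` {{i, j} | i j. i < s \<and> s \<le> j \<and> j < s + t}"
  proof (intro set_eqI iffI)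
    fix e assume "e \<in> {{a, v} | a v. a \<in> A \<and> v \<in> T}"
    then obtain i j where ij: "e = {f i, f j}" "i < s" "s \<le> j" "j < s + t"
      using f1 f2 by (auto simp: bij_betw_def)
    then have "e = f ` {i, j}" by simp
    then show "e \<in> (\<lambda>e. f ` e) ` {{i, j} | i j. i < s \<and> s \<le> j \<and> j < s + t}" using ij by blast
  next
    fix e assume "e \<in> (\<lambda>e. f ` e) ` {{i, j} | i j. i < s \<and> s \<le> j \<and> j < s + t}"
    then obtain i j where ij: "e = {f i, f j}" "i < s" "s \<le> j" "j < s + t" by auto
    then have "f i \<in> A" "f j \<in> T" using f1 f2 by (auto simp: bij_betw_def)
    then show "e \<in> {{a, v} | a v. a \<in> A \<and> v \<in> T}" using ij by blast
  qed
  then have "isomorphic (complete_bipartite s t)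
      \<lparr>verts = A \<union> T, edges = {{a, v} | a v. a \<in> A \<and> v \<in> T}\<rparr>"
    using f unfolding isomorphic_def complete_bipartite_def by auto
  moreover have "card e = 2 \<and> e \<subseteq> A \<union> T" if "e \<in> {{a, v} | a v. a \<in> A \<and> v \<in> T}" for e
    using that assms(2) by (auto simp: card_insert_if)
  then have "subgraph_of \<lparr>verts = A \<union> T, edges = {{a, v} | a v. a \<in> A \<and> v \<in> T}\<rparr> (complete_graph n)"
    using fin assms(1) unfolding subgraph_of_def simple_graph_def complete_graph_def
    by fastforce
  ultimately show ?thesis by (simp add: copy_of_in_def)
qed

definition has_orderable :: "nat sgraph \<Rightarrow> nat \<Rightarrow> (nat set \<Rightarrow> 'c) \<Rightarrow> bool" where
  "has_orderable G n \<chi> \<longleftrightarrow> (\<exists>C. copy_of_in C G (complete_graph n) \<and> orderable C \<chi>)"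

text \<open>No edge lies inside \<open>A\<close> or inside \<open>T\<close>, so positions have to
  differ only between the parts and many vertices of \<open>T\<close> may share one slot.\<close>

lemma has_orderable_bipartiteI:
  fixes pos :: "nat \<Rightarrow> nat"
  assumes "A \<union> T \<subseteq> {..<n}" "A \<inter> T = {}" "card A = s" "card T = t"
    and "\<And>a v. a \<in> A \<Longrightarrow> v \<in> T \<Longrightarrow> pos a \<noteq> pos v"
    and "\<And>a v. a \<in> A \<Longrightarrow> v \<in> T \<Longrightarrow> pos a < pos v \<Longrightarrow> \<chi> {v, a} = col a"
    and "\<And>a v. a \<in> A \<Longrightarrow> v \<in> T \<Longrightarrow> pos v < pos a \<Longrightarrow> \<chi> {v, a} = col v"
  shows "has_orderable (complete_bipartite s t) n \<chi>"
proof -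
  let ?C = "\<lparr>verts = A \<union> T, edges = {{a, v} | a v. a \<in> A \<and> v \<in> T}\<rparr>"
  have "orderable ?C \<chi>"
  proof (rule orderableI[where pos = pos and col = col])
    show "finite (verts ?C)" using assms(1) finite_subset by auto
  next
    fix x y assume xy: "{x, y} \<in> edges ?C" "pos x \<le> pos y"
    from xy(1) have "x \<in> A \<and> y \<in> T \<or> y \<in> A \<and> x \<in> T" by (auto simp: doubleton_eq_iff)
    then show "\<chi> {x, y} = col x"
    proof
      assume *: "x \<in> A \<and> y \<in> T"
      then show ?thesis using xy(2) assms(5)[of x y] assms(6)[of x y] by (simp add: insert_commute)
    next
      assume *: "y \<in> A \<and> x \<in> T"
      then show ?thesis using xy(2) assms(5)[of y x] assms(7)[of y x] by simp
    qed
  qed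
  then show ?thesis
    unfolding has_orderable_def using copy_complete_bipartiteI[OF assms(1-4)] by blast
qed

lemma has_orderable_bipartiteE:
  assumes "has_orderable (complete_bipartite s t) n \<chi>"
  obtains A T and pos :: "nat \<Rightarrow> nat" and col where
    "A \<union> T \<subseteq> {..<n}" "A \<inter> T = {}" "card A = s" "card T = t" "inj_on pos (A \<union> T)"
    "\<forall>a\<in>A. \<forall>v\<in>T. pos a < pos v \<longrightarrow> \<chi> {v, a} = col a"
    "\<forall>a\<in>A. \<forall>v\<in>T. pos v < pos a \<longrightarrow> \<chi> {v, a} = col v"
proof -
  obtain C where C: "copy_of_in C (complete_bipartite s t) (complete_graph n)" "orderable C \<chi>"
    using assms by (auto simp: has_orderable_def)
  obtain A T where AT: "verts C = A \<union> T" "A \<union> T \<subseteq> verts (complete_graph n)" "A \<inter> T = {}"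
    "card A = s" "card T = t" "edges C = {{a, v} | a v. a \<in> A \<and> v \<in> T}"
    by (rule copy_complete_bipartiteE[OF C(1)])
  obtain pos :: "nat \<Rightarrow> nat" and col where pos: "inj_on pos (verts C)"
    "\<forall>x\<in>verts C. \<forall>y\<in>verts C. {x, y} \<in> edges C \<and> pos x < pos y \<longrightarrow> \<chi> {x, y} = col x"
    by (rule orderableE[OF C(2)])
  have e: "{a, v} \<in> edges C" "{v, a} \<in> edges C" if "a \<in> A" "v \<in> T" for a v
    using that AT(6) by (auto simp: insert_commute)
  have "\<forall>a\<in>A. \<forall>v\<in>T. pos a < pos v \<longrightarrow> \<chi> {v, a} = col a"
    using pos(2)[rule_format, OF _ _ conjI[OF e(1)]] AT(1) by (simp add: insert_commute)
  moreover have "\<forall>a\<in>A. \<forall>v\<in>T. pos v < pos a \<longrightarrow> \<chi> {v, a} = col v"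
    using pos(2)[rule_format, OF _ _ conjI[OF e(2)]] AT(1) by simp
  ultimately show thesis
    using that[of A T pos col] AT pos(1) by (simp add: complete_graph_def)
qed

text \<open>Once \<open>a\<close> comes before \<open>b\<close> and \<open>a\<close> has colour
  \<open>p\<close>, each vertex of the large part is tested on its own. Any \<open>t\<close> fitting
  vertices then form a large part, so only their number matters.\<close>

lemma has_orderable_K2_iff:
  "has_orderable (complete_bipartite 2 t) n \<chi> \<longleftrightarrow>
    (\<exists>a<n. \<exists>b<n. \<exists>p. a \<noteq> b \<and> t \<le> card {v \<in> {..<n} - {a, b}. fits2 (\<chi> {v, a}) (\<chi> {v, b}) p})"
    (is "?L \<longleftrightarrow> ?R")
proof
  assume ?L
  then obtain A T and pos :: "nat \<Rightarrow> nat" and col where AT: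
    "A \<union> T \<subseteq> {..<n}" "A \<inter> T = {}" "card A = 2" "card T = t" "inj_on pos (A \<union> T)"
    "\<forall>a\<in>A. \<forall>v\<in>T. pos a < pos v \<longrightarrow> \<chi> {v, a} = col a"
    "\<forall>a\<in>A. \<forall>v\<in>T. pos v < pos a \<longrightarrow> \<chi> {v, a} = col v"
    by (rule has_orderable_bipartiteE)
  have "\<exists>a b. A = {a, b} \<and> pos a < pos b"
  proof -
    obtain x y where xy: "A = {x, y}" "x \<noteq> y" using AT(3) by (auto simp: card_2_iff)
    then have "pos x \<noteq> pos y" using AT(5) by (auto simp: inj_on_def)
    then show ?thesis using xy by (metis insert_commute linorder_neqE_nat)
  qed
  then obtain a b where ab: "A = {a, b}" "pos a < pos b" by blast
  have "T \<subseteq> {v \<in> {..<n} - {a, b}. fits2 (\<chi> {v, a}) (\<chi> {v, b}) (col a)}"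
  proof
    fix v assume v: "v \<in> T"
    have "v \<noteq> a" using v AT(2) ab by auto
    then have "pos v \<noteq> pos a" using v AT(5) ab by (auto simp: inj_on_def)
    then have "fits2 (\<chi> {v, a}) (\<chi> {v, b}) (col a)"
      using AT(6,7) v ab by (cases "pos v < pos a") (auto simp: fits2_def)
    then show "v \<in> {v \<in> {..<n} - {a, b}. fits2 (\<chi> {v, a}) (\<chi> {v, b}) (col a)}"
      using v AT(1,2) ab by auto
  qed
  then have "t \<le> card {v \<in> {..<n} - {a, b}. fits2 (\<chi> {v, a}) (\<chi> {v, b}) (col a)}"
    unfolding AT(4)[symmetric] by (intro card_mono) auto
  moreover have "a < n" "b < n" "a \<noteq> b" using ab AT(1) by auto
  ultimately show ?R by blast
next
  assume ?R
  then obtain a b p where ab: "a < n" "b < n" "a \<noteq> b"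
    "t \<le> card {v \<in> {..<n} - {a, b}. fits2 (\<chi> {v, a}) (\<chi> {v, b}) p}" by blast
  obtain T where T: "T \<subseteq> {v \<in> {..<n} - {a, b}. fits2 (\<chi> {v, a}) (\<chi> {v, b}) p}"
    "card T = t" "finite T"
    by (rule obtain_subset_with_card_n[OF ab(4)])
  \<comment> \<open>\<open>a\<close> and \<open>b\<close> take the odd slots, \<open>T\<close> the
    even ones. A vertex with two equal colours goes before \<open>a\<close>; any other goes between
    \<open>a\<close> and \<open>b\<close>, sending \<open>p\<close> to \<open>a\<close> by
    \<open>fits2\<close> and its own listed colour to \<open>b\<close>.\<close>
  define pos :: "nat \<Rightarrow> nat" where "pos v = (if v = a then 1 else if v = b then 3
    else if \<chi> {v, a} = \<chi> {v, b} then 0 else 2)" for v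
  define col where "col v = (if v = a then p else \<chi> {v, b})" for v
  have ft: "fits2 (\<chi> {v, a}) (\<chi> {v, b}) p" "v \<noteq> a" "v \<noteq> b" "v < n" if "v \<in> T" for v
    using that T(1) by auto
  show ?L
  proof (rule has_orderable_bipartiteI[where pos = pos and col = col])
    show "{a, b} \<union> T \<subseteq> {..<n}" "{a, b} \<inter> T = {}" "card {a, b} = 2" "card T = t"
      using ab T by auto
  next
    fix x v assume xv: "x \<in> {a, b}" "v \<in> T"
    note f = ft[OF xv(2)]
    show "pos x \<noteq> pos v" using xv(1) f by (auto simp: pos_def)
    show "\<chi> {v, x} = col x" if "pos x < pos v"
      using that xv(1) f \<open>a \<noteq> b\<close> by (auto simp: pos_def col_def fits2_def split: if_splits)
    show "\<chi> {v, x} = col v" if "pos v < pos x"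
      using that xv(1) f \<open>a \<noteq> b\<close> by (auto simp: pos_def col_def fits2_def split: if_splits)
  qed
qed

lemma has_orderable_K3_iff:
  "has_orderable (complete_bipartite 3 t) n \<chi> \<longleftrightarrow>
    (\<exists>a<n. \<exists>b<n. \<exists>d<n. \<exists>p q. a \<noteq> b \<and> a \<noteq> d \<and> b \<noteq> d \<and>
      t \<le> card {v \<in> {..<n} - {a, b, d}. fits3 (\<chi> {v, a}) (\<chi> {v, b}) (\<chi> {v, d}) p q})"
    (is "?L \<longleftrightarrow> ?R")
proof
  assume ?L
  then obtain A T and pos :: "nat \<Rightarrow> nat" and col where AT:
    "A \<union> T \<subseteq> {..<n}" "A \<inter> T = {}" "card A = 3" "card T = t" "inj_on pos (A \<union> T)"
    "\<forall>a\<in>A. \<forall>v\<in>T. pos a < pos v \<longrightarrow> \<chi> {v, a} = col a"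
    "\<forall>a\<in>A. \<forall>v\<in>T. pos v < pos a \<longrightarrow> \<chi> {v, a} = col v"
    by (rule has_orderable_bipartiteE)
  have "\<exists>a b d. A = {a, b, d} \<and> pos a < pos b \<and> pos b < pos d"
  proof -
    obtain x y z where xyz: "A = {x, y, z}" "x \<noteq> y" "y \<noteq> z" "x \<noteq> z"
      using AT(3) by (auto simp: card_3_iff)
    then have "pos x \<noteq> pos y" "pos y \<noteq> pos z" "pos x \<noteq> pos z"
      using AT(5) by (auto simp: inj_on_def)
    then consider "pos x < pos y" "pos y < pos z" | "pos x < pos z" "pos z < pos y"
      | "pos y < pos x" "pos x < pos z" | "pos y < pos z" "pos z < pos x"
      | "pos z < pos x" "pos x < pos y" | "pos z < pos y" "pos y < pos x" by linarith
    moreover have "A = {x, z, y}" "A = {y, x, z}" "A = {y, z, x}" "A = {z, x, y}" "A = {z, y, x}"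
      using xyz(1) by auto
    ultimately show ?thesis using xyz(1) by cases blast+
  qed
  then obtain a b d where abd: "A = {a, b, d}" "pos a < pos b" "pos b < pos d" by blast
  have "T \<subseteq> {v \<in> {..<n} - {a, b, d}. fits3 (\<chi> {v, a}) (\<chi> {v, b}) (\<chi> {v, d}) (col a) (col b)}"
  proof
    fix v assume v: "v \<in> T"
    have "v \<noteq> a" "v \<noteq> b" using v AT(2) abd by auto
    then have "pos v \<noteq> pos a" "pos v \<noteq> pos b" using v AT(5) abd by (auto simp: inj_on_def)
    then consider "pos v < pos a" | "pos a < pos v" "pos v < pos b" | "pos b < pos v" by linarith
    then have "fits3 (\<chi> {v, a}) (\<chi> {v, b}) (\<chi> {v, d}) (col a) (col b)"
    proof cases
      case 1
      then have "\<chi> {v, x} = col v" if "x \<in> {a, b, d}" for x using AT(7) v that abd by auto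
      then show ?thesis by (simp add: fits3_def)
    next
      case 2
      then have "\<chi> {v, x} = col v" if "x \<in> {b, d}" for x using AT(7) v that abd by auto
      moreover have "\<chi> {v, a} = col a" using AT(6) v abd(1) 2 by auto
      ultimately show ?thesis by (simp add: fits3_def)
    next
      case 3
      then have "\<chi> {v, x} = col x" if "x \<in> {a, b}" for x using AT(6) v that abd by auto
      then show ?thesis by (simp add: fits3_def)
    qed
    then show "v \<in> {v \<in> {..<n} - {a, b, d}. fits3 (\<chi> {v, a}) (\<chi> {v, b}) (\<chi> {v, d}) (col a) (col b)}"
      using v AT(1,2) abd by auto
  qed
  then have "t \<le> card {v \<in> {..<n} - {a, b, d}. fits3 (\<chi> {v, a}) (\<chi> {v, b}) (\<chi> {v, d}) (col a) (col b)}"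
    unfolding AT(4)[symmetric] by (intro card_mono) auto
  moreover have "a < n" "b < n" "d < n" "a \<noteq> b" "a \<noteq> d" "b \<noteq> d" using abd AT(1) by auto
  ultimately show ?R by blast
next
  assume ?R
  then obtain a b d p q where abd: "a < n" "b < n" "d < n" "a \<noteq> b" "a \<noteq> d" "b \<noteq> d"
    "t \<le> card {v \<in> {..<n} - {a, b, d}. fits3 (\<chi> {v, a}) (\<chi> {v, b}) (\<chi> {v, d}) p q}" by blast
  obtain T where T: "T \<subseteq> {v \<in> {..<n} - {a, b, d}. fits3 (\<chi> {v, a}) (\<chi> {v, b}) (\<chi> {v, d}) p q}"
    "card T = t" "finite T"
    by (rule obtain_subset_with_card_n[OF abd(7)])
  \<comment> \<open>Slots 0, 2 and 4 realise the three ways to fit. A vertex in slot 4 sends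
    \<open>p\<close> to \<open>a\<close> and \<open>q\<close> to \<open>b\<close>, and still
    precedes \<open>d\<close>, so the colour to \<open>d\<close> is its own.\<close>
  define pos :: "nat \<Rightarrow> nat" where "pos v = (if v = a then 1 else if v = b then 3 else if v = d then 5
    else if \<chi> {v, a} = \<chi> {v, b} \<and> \<chi> {v, b} = \<chi> {v, d} then 0
    else if \<chi> {v, b} = \<chi> {v, d} then 2 else 4)" for v
  define col where "col v = (if v = a then p else if v = b then q else \<chi> {v, d})" for v
  have ft: "fits3 (\<chi> {v, a}) (\<chi> {v, b}) (\<chi> {v, d}) p q" "v \<noteq> a" "v \<noteq> b" "v \<noteq> d" "v < n"
    if "v \<in> T" for v using that T(1) by auto
  show ?L
  proof (rule has_orderable_bipartiteI[where pos = pos and col = col])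
    show "{a, b, d} \<union> T \<subseteq> {..<n}" "{a, b, d} \<inter> T = {}" "card {a, b, d} = 3" "card T = t"
      using abd T by auto
  next
    fix x v assume xv: "x \<in> {a, b, d}" "v \<in> T"
    note f = ft[OF xv(2)]
    show "pos x \<noteq> pos v" using xv(1) f by (auto simp: pos_def)
    show "\<chi> {v, x} = col x" if "pos x < pos v"
      using that xv(1) f abd(4-6) by (auto simp: pos_def col_def fits3_def split: if_splits)
    show "\<chi> {v, x} = col v" if "pos v < pos x"
      using that xv(1) f abd(4-6) by (auto simp: pos_def col_def fits3_def split: if_splits)
  qed
qed

section \<open>Ramsey numbers\<close>

text \<open>Thus one colouring without an orderable copy at \<open>n\<close> also settles all
  smaller values.\<close>

lemma has_orderable_mono:
  assumes "has_orderable G m \<chi>" "m \<le> n"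
  shows "has_orderable G n \<chi>"
proof -
  have "e \<subseteq> {..<n}" if "e \<subseteq> {..<m}" for e
    using that \<open>m \<le> n\<close> by (auto dest!: subsetD)
  then have "verts (complete_graph m) \<subseteq> verts (complete_graph n)"
    "edges (complete_graph m) \<subseteq> edges (complete_graph n)"
    using assms(2) by (simp_all add: complete_graph_def Collect_mono_iff)
  then have "copy_of_in C G (complete_graph n)" if "copy_of_in C G (complete_graph m)" for C
    using that unfolding copy_of_in_def subgraph_of_def by blast
  then show ?thesis using assms(1) unfolding has_orderable_def by blast
qed

section \<open>Rainbow triangles\<close>

lemma edges_K3: "edges (complete_graph 3) = {{0, 1}, {1, 2}, {0, 2}}"
proof -
  have "e \<in> {{0, 1}, {1, 2}, {0, 2}}" if e: "e \<subseteq> {..<3}" "card e = 2" for e :: "nat set"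
  proof -
    obtain x y where xy: "e = {x, y}" "x \<noteq> y" using e(2) by (auto simp: card_2_iff)
    then have "x \<in> {0, 1, 2}" "y \<in> {0, 1, 2}" using e(1) by auto
    then show ?thesis using xy by auto
  qed
  then show ?thesis by (auto simp: complete_graph_def)
qed

lemma rainbow_triangleI:
  assumes "x < n" "y < n" "z < n" "x \<noteq> y" "y \<noteq> z" "x \<noteq> z"
    and "\<chi> {x, y} \<noteq> \<chi> {y, z}" "\<chi> {x, y} \<noteq> \<chi> {x, z}" "\<chi> {y, z} \<noteq> \<chi> {x, z}"
  shows "\<exists>C. copy_of_in C (complete_graph 3) (complete_graph n) \<and> rainbow C \<chi>"
proof (intro exI conjI)
  let ?C = "\<lparr>verts = {x, y, z}, edges = {{x, y}, {y, z}, {x, z}}\<rparr>"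
  let ?f = "\<lambda>i::nat. if i = 0 then x else if i = 1 then y else z"
  have three: "{..<3} = {0, 1, 2::nat}" by auto
  have "bij_betw ?f {..<3} {x, y, z}"
    unfolding three bij_betw_def using assms by (auto simp: inj_on_def)
  moreover have "{{x, y}, {y, z}, {x, z}} = (\<lambda>e. ?f ` e) ` {{0, 1}, {1, 2}, {0, 2}}"
    by (simp add: insert_commute)
  ultimately have "isomorphic (complete_graph 3) ?C"
    unfolding isomorphic_def edges_K3 by (intro exI[of _ ?f]) (simp add: complete_graph_def)
  moreover have "subgraph_of ?C (complete_graph n)"
    using assms by (auto simp: subgraph_of_def simple_graph_def complete_graph_def)
  ultimately show "copy_of_in ?C (complete_graph 3) (complete_graph n)"
    by (simp add: copy_of_in_def)
  show "rainbow ?C \<chi>" using assms by (auto simp: rainbow_def inj_on_def)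
qed

lemma not_rainbow_two_colors:
  assumes "\<chi> ` edges (complete_graph n) \<subseteq> {0, 1::nat}"
    and "copy_of_in C (complete_graph 3) (complete_graph n)"
  shows "\<not> rainbow C \<chi>"
proof
  assume "rainbow C \<chi>"
  obtain f where f: "bij_betw f {..<3::nat} (verts C)"
    and E: "edges C = (\<lambda>e. f ` e) ` {{0, 1}, {1, 2}, {0, 2}}"
    and sub: "edges C \<subseteq> edges (complete_graph n)"
    using assms(2) unfolding copy_of_in_def isomorphic_def subgraph_of_def edges_K3
    by (auto simp: complete_graph_def)
  have "f 0 \<noteq> f 1" "f 1 \<noteq> f 2" "f 0 \<noteq> f 2"
    using inj_onD[OF bij_betw_imp_inj_on[OF f], of 0 1]
      inj_onD[OF bij_betw_imp_inj_on[OF f], of 1 2] inj_onD[OF bij_betw_imp_inj_on[OF f], of 0 2]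
    by auto
  then have "card (edges C) = 3" unfolding E by (auto simp: card_insert_if doubleton_eq_iff)
  moreover have "card (edges C) \<le> card {0, 1::nat}"
  proof (rule card_inj_on_le)
    show "inj_on \<chi> (edges C)" using \<open>rainbow C \<chi>\<close> by (simp add: rainbow_def)
    show "\<chi> ` edges C \<subseteq> {0, 1}" using image_mono[OF sub] assms(1) by (rule subset_trans)
  qed simp
  ultimately show False by simp
qed

lemma Inf_enat_eqI:
  assumes "P N" "\<And>n. n < N \<Longrightarrow> \<not> P n"
  shows "Inf {enat n | n. P n} = enat N"
proof (rule antisym)
  show "Inf {enat n | n. P n} \<le> enat N" using assms(1) by (auto intro: Inf_lower)
  show "enat N \<le> Inf {enat n | n. P n}"
    using assms(2) by (intro Inf_greatest) (auto simp: not_less[symmetric])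
qed

text \<open>Two colours admit no rainbow triangle. Hence the upper estimate for \<open>CR\<close>
  specialises to \<open>orderable_ramsey2\<close>, and a two-coloured example bounds both from
  below. Restricting \<open>range \<chi>0\<close> lets the same function colour every
  \<open>complete_graph n\<close>.\<close>

lemma orderable_ramsey_eqI:
  fixes \<chi>0 :: "nat set \<Rightarrow> nat"
  assumes up: "\<And>\<chi> :: nat set \<Rightarrow> nat. has_orderable G (Suc N) \<chi> \<or>
      (\<exists>C. copy_of_in C (complete_graph 3) (complete_graph (Suc N)) \<and> rainbow C \<chi>)"
    and low: "range \<chi>0 \<subseteq> {0, 1}" "\<not> has_orderable G N \<chi>0"
  shows "orderable_ramsey2 G = enat (Suc N)" "CR G (complete_graph 3) = enat (Suc N)"
proof -
  have low': "\<not> has_orderable G n \<chi>0" if "n < Suc N" for n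
    using that low(2) has_orderable_mono by (metis less_Suc_eq_le)
  have two: "\<chi>0 ` E \<subseteq> {0, 1}" for E
    using image_mono[OF subset_UNIV] low(1) by (rule subset_trans)
  show "orderable_ramsey2 G = enat (Suc N)"
    unfolding orderable_ramsey2_def has_orderable_def[symmetric]
  proof (rule Inf_enat_eqI)
    show "\<forall>\<chi> :: nat set \<Rightarrow> nat. \<chi> ` edges (complete_graph (Suc N)) \<subseteq> {0, 1} \<longrightarrow>
        has_orderable G (Suc N) \<chi>"
      using up not_rainbow_two_colors by blast
    show "\<not> (\<forall>\<chi> :: nat set \<Rightarrow> nat. \<chi> ` edges (complete_graph n) \<subseteq> {0, 1} \<longrightarrow> has_orderable G n \<chi>)"
      if "n < Suc N" for n
    proof
      assume h: "\<forall>\<chi> :: nat set \<Rightarrow> nat. \<chi> ` edges (complete_graph n) \<subseteq> {0, 1} \<longrightarrow> has_orderable G n \<chi>"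
      show False using h[rule_format, OF two] low'[OF that] by simp
    qed
  qed
  show "CR G (complete_graph 3) = enat (Suc N)"
    unfolding CR_def has_orderable_def[symmetric]
  proof (rule Inf_enat_eqI)
    show "\<forall>\<chi> :: nat set \<Rightarrow> nat. has_orderable G (Suc N) \<chi> \<or>
        (\<exists>C. copy_of_in C (complete_graph 3) (complete_graph (Suc N)) \<and> rainbow C \<chi>)"
      using up by blast
    show "\<not> (\<forall>\<chi> :: nat set \<Rightarrow> nat. has_orderable G n \<chi> \<or>
        (\<exists>C. copy_of_in C (complete_graph 3) (complete_graph n) \<and> rainbow C \<chi>))"
      if "n < Suc N" for n
    proof -
      have "\<not> rainbow C \<chi>0" if "copy_of_in C (complete_graph 3) (complete_graph n)" for C
        using two that by (rule not_rainbow_two_colors)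
      then show ?thesis using low'[OF that] by blast
    qed
  qed
qed

section \<open>Upper bounds\<close>

lemma sym_coloring_edges: "sym_coloring (\<lambda>x y. \<chi> {x, y})"
  by unfold_locales (simp add: insert_commute)

lemma no_rainbow_edges:
  assumes "\<not> (\<exists>C. copy_of_in C (complete_graph 3) (complete_graph n) \<and> rainbow C \<chi>)"
  shows "sym_coloring.no_rainbow (\<lambda>x y. \<chi> {x, y}) {..<n}"
  unfolding sym_coloring.no_rainbow_def[OF sym_coloring_edges]
proof (intro ballI impI; elim conjE; rule ccontr)
  fix x y z
  assume "x \<in> {..<n}" "y \<in> {..<n}" "z \<in> {..<n}" "x \<noteq> y" "y \<noteq> z" "x \<noteq> z"
    and "\<not> (\<chi> {x, y} = \<chi> {y, z} \<or> \<chi> {x, y} = \<chi> {x, z} \<or> \<chi> {y, z} = \<chi> {x, z})"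
  then show False using assms rainbow_triangleI[of x n y z \<chi>] by simp
qed

text \<open>From \<open>4 * card (bad2 ...) \<le> 4 * s + 1\<close> at most \<open>s\<close> of the
  \<open>4 * s\<close> vertices outside \<open>{a, b}\<close> are bad.\<close>

lemma K2_upper:
  "has_orderable (complete_bipartite 2 (3 * s)) (4 * s + 2) \<chi> \<or>
    (\<exists>C. copy_of_in C (complete_graph 3) (complete_graph (4 * s + 2)) \<and> rainbow C \<chi>)"
proof (rule disjCI)
  let ?n = "4 * s + 2"
  assume no: "\<not> (\<exists>C. copy_of_in C (complete_graph 3) (complete_graph ?n) \<and> rainbow C \<chi>)"
  interpret sym_coloring "\<lambda>x y. \<chi> {x, y}" by (rule sym_coloring_edges)
  have "2 \<le> card {..<?n}" by simp
  then obtain a b p where ab: "a < ?n" "b < ?n" "a \<noteq> b"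
    "4 * card (bad2 {..<?n} a b p) \<le> card {..<?n} - 1"
    using ex_few_bad2[OF finite_lessThan no_rainbow_edges[OF no]] by (metis lessThan_iff)
  have "{v \<in> {..<?n} - {a, b}. fits2 (\<chi> {v, a}) (\<chi> {v, b}) p} = {..<?n} - {a, b} - bad2 {..<?n} a b p"
    by (auto simp: bad2_def)
  also have "card \<dots> \<ge> card ({..<?n} - {a, b}) - card (bad2 {..<?n} a b p)"
    by (rule diff_card_le_card_Diff) (simp add: bad2_def)
  finally have "3 * s \<le> card {v \<in> {..<?n} - {a, b}. fits2 (\<chi> {v, a}) (\<chi> {v, b}) p}"
    using ab by simp
  then show "has_orderable (complete_bipartite 2 (3 * s)) ?n \<chi>"
    unfolding has_orderable_K2_iff using ab by blast
qed

text \<open>At most \<open>(4 * s - 1) div 2 = 2 * s - 1\<close> of the \<open>4 * s - 1\<close>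
  vertices outside the triple are bad.\<close>

lemma K3_upper:
  assumes "s > 0"
  shows "has_orderable (complete_bipartite 3 (2 * s)) (4 * s + 2) \<chi> \<or>
    (\<exists>C. copy_of_in C (complete_graph 3) (complete_graph (4 * s + 2)) \<and> rainbow C \<chi>)"
proof (rule disjCI)
  let ?n = "4 * s + 2"
  assume no: "\<not> (\<exists>C. copy_of_in C (complete_graph 3) (complete_graph ?n) \<and> rainbow C \<chi>)"
  interpret sym_coloring "\<lambda>x y. \<chi> {x, y}" by (rule sym_coloring_edges)
  have "3 \<le> card {..<?n}" using assms by simp
  from ex_few_bad3[OF finite_lessThan no_rainbow_edges[OF no] this]
  obtain a b d p q where abd: "a < ?n" "b < ?n" "d < ?n" "a \<noteq> b" "a \<noteq> d" "b \<noteq> d"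
    "card (bad3 {..<?n} a b d p q) \<le> (card {..<?n} - 3) div 2"
    by (auto simp del: card_lessThan)
  have "{v \<in> {..<?n} - {a, b, d}. fits3 (\<chi> {v, a}) (\<chi> {v, b}) (\<chi> {v, d}) p q}
      = {..<?n} - {a, b, d} - bad3 {..<?n} a b d p q"
    by (auto simp: bad3_def)
  also have "card \<dots> \<ge> card ({..<?n} - {a, b, d}) - card (bad3 {..<?n} a b d p q)"
    by (rule diff_card_le_card_Diff) (simp add: bad3_def)
  finally have "2 * s \<le> card {v \<in> {..<?n} - {a, b, d}. fits3 (\<chi> {v, a}) (\<chi> {v, b}) (\<chi> {v, d}) p q}"
    using abd assms by (simp add: card_Diff_subset)
  then show "has_orderable (complete_bipartite 3 (2 * s)) ?n \<chi>"
    unfolding has_orderable_K3_iff using abd by blast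
qed

section \<open>Lower bounds from conference graphs\<close>

text \<open>In a conference graph, each of two vertices has equally many private neighbours,
  whether or not the two are adjacent.\<close>

lemma conference_private_nbrs:
  assumes G: "is_SRG G (4 * s + 1) (2 * s) (s - 1) s" and "s > 0"
    and ab: "a \<in> verts G" "b \<in> verts G" "a \<noteq> b"
  shows "card {v \<in> verts G - {a, b}. {v, a} \<in> edges G \<and> {v, b} \<notin> edges G} = s"
proof -
  have fin: "finite (verts G)" and e2: "\<And>e. e \<in> edges G \<Longrightarrow> card e = 2"
    and deg: "card (nbrs G a) = 2 * s"
    and adj: "{a, b} \<in> edges G \<Longrightarrow> card (nbrs G a \<inter> nbrs G b) = s - 1"
    and nadj: "{a, b} \<notin> edges G \<Longrightarrow> card (nbrs G a \<inter> nbrs G b) = s"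
    using G ab unfolding is_SRG_def simple_graph_def by auto
  have loop: "{x, x} \<notin> edges G" for x using e2[of "{x, x}"] by auto
  have finN: "finite (nbrs G x)" for x using fin by (simp add: nbrs_def)
  have "{v \<in> verts G - {a, b}. {v, a} \<in> edges G \<and> {v, b} \<notin> edges G}
      = nbrs G a - (nbrs G a \<inter> nbrs G b) - {b}"
    using loop by (auto simp: nbrs_def insert_commute)
  also have "card \<dots> = s"
  \<comment> \<open>If \<open>a\<close> and \<open>b\<close> are adjacent, \<open>b\<close> itself
    has to be discarded: \<open>2 * s - (s - 1) - 1 = s\<close>. Otherwise the count is
    \<open>2 * s - s\<close>.\<close>
  proof (cases "{a, b} \<in> edges G")
    case True
    have "b \<in> nbrs G a - (nbrs G a \<inter> nbrs G b)" using True ab loop by (auto simp: nbrs_def)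
    then show ?thesis
      using deg adj[OF True] finN \<open>s > 0\<close> by (simp add: card_Diff_subset)
  next
    case False
    have "nbrs G a - (nbrs G a \<inter> nbrs G b) - {b} = nbrs G a - (nbrs G a \<inter> nbrs G b)"
      using False by (auto simp: nbrs_def)
    then show ?thesis using deg nadj[OF False] finN by (simp add: card_Diff_subset)
  qed
  finally show ?thesis .
qed

text \<open>The graph is carried over to \<open>{..<4 * s + 1}\<close>, with edges in colour 1 and
  everything else in colour 0. Exchanging \<open>X\<close> and \<open>Y\<close> amounts to
  exchanging \<open>a\<close> and \<open>b\<close>, so the count of private neighbours covers both
  cases.\<close>

lemma conference_coloring:
  assumes "SRG_exists (4 * s + 1) (2 * s) (s - 1) s" "s > 0"
  obtains \<chi> :: "nat set \<Rightarrow> nat" where "range \<chi> \<subseteq> {0, 1}"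
    "\<And>a b X Y. a < 4 * s + 1 \<Longrightarrow> b < 4 * s + 1 \<Longrightarrow> a \<noteq> b \<Longrightarrow> X \<in> {0, 1} \<Longrightarrow> Y \<in> {0, 1} \<Longrightarrow> X \<noteq> Y \<Longrightarrow>
      card {v \<in> {..<4 * s + 1} - {a, b}. \<chi> {v, a} = X \<and> \<chi> {v, b} = Y} = s"
proof -
  let ?n = "4 * s + 1"
  obtain G :: "nat sgraph" where G: "is_SRG G ?n (2 * s) (s - 1) s"
    using assms(1) by (auto simp: SRG_exists_def)
  then have "finite (verts G)" "card (verts G) = ?n" by (auto simp: is_SRG_def simple_graph_def)
  then obtain g where g: "bij_betw g {..<?n} (verts G)"
    using ex_bij_betw_nat_finite by (metis atLeast0LessThan)
  define \<chi> :: "nat set \<Rightarrow> nat" where "\<chi> e = (if g ` e \<in> edges G then 1 else 0)" for e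
  have inj: "inj_on g {..<?n}" and img: "g ` {..<?n} = verts G" using g by (auto simp: bij_betw_def)
  have priv: "card {v \<in> {..<?n} - {a, b}. \<chi> {v, a} = 1 \<and> \<chi> {v, b} = 0} = s"
    if ab: "a < ?n" "b < ?n" "a \<noteq> b" for a b
  proof -
    let ?L = "{v \<in> {..<?n} - {a, b}. \<chi> {v, a} = 1 \<and> \<chi> {v, b} = 0}"
    have gab: "g a \<in> verts G" "g b \<in> verts G" "g a \<noteq> g b"
      using ab img inj by (auto simp: inj_on_def)
    have "g ` ?L = {w \<in> verts G - {g a, g b}. {w, g a} \<in> edges G \<and> {w, g b} \<notin> edges G}"
    proof (intro set_eqI iffI)
      fix w assume "w \<in> g ` ?L"
      then obtain v where v: "v \<in> ?L" "w = g v" by blast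
      then have "g v \<noteq> g a" "g v \<noteq> g b" using ab inj by (auto simp: inj_on_def)
      then show "w \<in> {w \<in> verts G - {g a, g b}. {w, g a} \<in> edges G \<and> {w, g b} \<notin> edges G}"
        using v img by (auto simp: \<chi>_def split: if_splits)
    next
      fix w assume w: "w \<in> {w \<in> verts G - {g a, g b}. {w, g a} \<in> edges G \<and> {w, g b} \<notin> edges G}"
      then obtain v where "v < ?n" "w = g v" using img by auto
      then show "w \<in> g ` ?L" using w by (auto simp: \<chi>_def)
    qed
    moreover have "card (g ` ?L) = card ?L"
      by (intro card_image inj_on_subset[OF inj]) auto
    ultimately show ?thesis using conference_private_nbrs[OF G assms(2) gab] by simp
  qed
  show thesis
  proof (rule that)
    show "range \<chi> \<subseteq> {0, 1}" by (auto simp: \<chi>_def)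
    fix a b X Y :: nat
    assume *: "a < ?n" "b < ?n" "a \<noteq> b" "X \<in> {0, 1}" "Y \<in> {0, 1}" "X \<noteq> Y"
    then consider "X = 1" "Y = 0" | "X = 0" "Y = 1" by auto
    then show "card {v \<in> {..<?n} - {a, b}. \<chi> {v, a} = X \<and> \<chi> {v, b} = Y} = s"
    proof cases
      case 1
      then show ?thesis using priv * by simp
    next
      case 2
      have "{v \<in> {..<?n} - {a, b}. \<chi> {v, a} = X \<and> \<chi> {v, b} = Y}
          = {v \<in> {..<?n} - {b, a}. \<chi> {v, b} = 1 \<and> \<chi> {v, a} = 0}" using 2 by auto
      then show ?thesis using priv[of b a] * by simp
    qed
  qed
qed

lemma K2_lower:
  fixes \<chi> :: "nat set \<Rightarrow> nat"
  assumes "s > 0"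
    and conf: "\<And>a b X Y. a < 4 * s + 1 \<Longrightarrow> b < 4 * s + 1 \<Longrightarrow> a \<noteq> b \<Longrightarrow> X \<in> {0, 1} \<Longrightarrow> Y \<in> {0, 1} \<Longrightarrow> X \<noteq> Y \<Longrightarrow>
      card {v \<in> {..<4 * s + 1} - {a, b}. \<chi> {v, a} = X \<and> \<chi> {v, b} = Y} = s"
  shows "\<not> has_orderable (complete_bipartite 2 (3 * s)) (4 * s + 1) \<chi>"
proof
  let ?n = "4 * s + 1"
  assume "has_orderable (complete_bipartite 2 (3 * s)) ?n \<chi>"
  then obtain a b p where ab: "a < ?n" "b < ?n" "a \<noteq> b"
    and le: "3 * s \<le> card {v \<in> {..<?n} - {a, b}. fits2 (\<chi> {v, a}) (\<chi> {v, b}) p}"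
    unfolding has_orderable_K2_iff by blast
  \<comment> \<open>One of the two colours differs from \<open>p\<close>, whatever number
    \<open>p\<close> is. The \<open>s\<close> vertices sending \<open>X\<close> to \<open>a\<close>
    and the other colour to \<open>b\<close> do not fit, which leaves \<open>4 * s - 1 - s\<close>,
    one short of \<open>3 * s\<close>.\<close>
  define X :: nat where "X = (if p = 0 then 1 else 0)"
  define S where "S = {v \<in> {..<?n} - {a, b}. \<chi> {v, a} = X \<and> \<chi> {v, b} = 1 - X}"
  have S: "card S = s" "S \<subseteq> {..<?n} - {a, b}"
    using conf[OF ab, of X "1 - X"] by (auto simp: S_def X_def)
  have "{v \<in> {..<?n} - {a, b}. fits2 (\<chi> {v, a}) (\<chi> {v, b}) p} \<subseteq> {..<?n} - {a, b} - S"
    by (auto simp: S_def X_def fits2_def split: if_splits)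
  then have "3 * s \<le> card ({..<?n} - {a, b} - S)"
    using le card_mono[of "{..<?n} - {a, b} - S"] by (meson finite_Diff finite_lessThan le_trans)
  also have "\<dots> = card ({..<?n} - {a, b}) - card S"
    using S by (intro card_Diff_subset) (auto intro: finite_subset)
  also have "\<dots> = 3 * s - 1" using ab S by simp
  finally show False using \<open>s > 0\<close> by simp
qed

text \<open>Two disjoint sets of \<open>s\<close> misfits are united, one failing at
  \<open>p\<close> and the other at \<open>q\<close>. Each may contain the remaining vertex of the
  triple, but not both do, so \<open>2 * s - 1\<close> misfits stay outside the triple and at most
  \<open>4 * s - 2 - (2 * s - 1)\<close> vertices fit.\<close>

lemma K3_lower:
  fixes \<chi> :: "nat set \<Rightarrow> nat"
  assumes "s > 0"
    and conf: "\<And>a b X Y. a < 4 * s + 1 \<Longrightarrow> b < 4 * s + 1 \<Longrightarrow> a \<noteq> b \<Longrightarrow> X \<in> {0, 1} \<Longrightarrow> Y \<in> {0, 1} \<Longrightarrow> X \<noteq> Y \<Longrightarrow>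
      card {v \<in> {..<4 * s + 1} - {a, b}. \<chi> {v, a} = X \<and> \<chi> {v, b} = Y} = s"
  shows "\<not> has_orderable (complete_bipartite 3 (2 * s)) (4 * s + 1) \<chi>"
proof
  let ?n = "4 * s + 1"
  assume "has_orderable (complete_bipartite 3 (2 * s)) ?n \<chi>"
  then obtain a b d p q where abd: "a < ?n" "b < ?n" "d < ?n" "a \<noteq> b" "a \<noteq> d" "b \<noteq> d"
    and le: "2 * s \<le> card {v \<in> {..<?n} - {a, b, d}. fits3 (\<chi> {v, a}) (\<chi> {v, b}) (\<chi> {v, d}) p q}"
    unfolding has_orderable_K3_iff by blast
  obtain X Y :: nat where X: "X \<in> {0, 1}" "Y \<in> {0, 1}" "X \<noteq> Y" "X \<noteq> p"
    using that[of 0 1] that[of 1 0] by (cases "p = 0") auto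
  define S where "S x y P Q = {v \<in> {..<?n} - {x, y}. \<chi> {v, x} = P \<and> \<chi> {v, y} = Q}" for x y P Q
  have finS: "finite (S x y P Q)" for x y P Q by (simp add: S_def)
  have cS: "card (S x y X Y) = s" "card (S x y Y X) = s"
    if "x < ?n" "y < ?n" "x \<noteq> y" for x y
    using conf[OF that X(1-3)] conf[OF that X(2,1) X(3)[symmetric]] by (simp_all only: S_def)
  have bound: "2 * s - 1 \<le> card ((S1 - {y}) \<union> (S2 - {x}))"
    if "finite S1" "finite S2" "card S1 = s" "card S2 = s" "S1 \<inter> S2 = {}" "\<not> (y \<in> S1 \<and> x \<in> S2)"
    for S1 S2 :: "nat set" and x y
  proof -
    have "card ((S1 - {y}) \<union> (S2 - {x})) = card (S1 - {y}) + card (S2 - {x})"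
      using that by (intro card_Un_disjoint) auto
    then show ?thesis using that by (cases "y \<in> S1"; cases "x \<in> S2") auto
  qed
  have "\<exists>U\<subseteq>{..<?n} - {a, b, d}. 2 * s - 1 \<le> card U \<and>
      (\<forall>v\<in>U. \<not> fits3 (\<chi> {v, a}) (\<chi> {v, b}) (\<chi> {v, d}) p q)"
  proof (cases "q = X")
    case False
    let ?U = "(S a b X Y - {d}) \<union> (S b d X Y - {a})"
    have "2 * s - 1 \<le> card ?U"
    proof (rule bound[OF finS finS cS(1)[OF abd(1,2,4)] cS(1)[OF abd(2,3,6)]])
      show "S a b X Y \<inter> S b d X Y = {}" using X(3) by (auto simp: S_def)
      \<comment> \<open>Otherwise the edge between \<open>a\<close> and \<open>d\<close> would have
        both colours.\<close>
      show "\<not> (d \<in> S a b X Y \<and> a \<in> S b d X Y)"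
        using X(3) insert_commute[of a d "{}"] by (auto simp: S_def)
    qed
    moreover have "\<forall>v\<in>?U. \<not> fits3 (\<chi> {v, a}) (\<chi> {v, b}) (\<chi> {v, d}) p q"
    proof
      fix v assume "v \<in> ?U"
      then consider "\<chi> {v, a} = X \<and> \<chi> {v, b} = Y" | "\<chi> {v, b} = X \<and> \<chi> {v, d} = Y"
        by (auto simp: S_def)
      then show "\<not> fits3 (\<chi> {v, a}) (\<chi> {v, b}) (\<chi> {v, d}) p q"
        using X(3,4) False by cases (simp_all add: fits3_def)
    qed
    moreover have "?U \<subseteq> {..<?n} - {a, b, d}" by (auto simp: S_def)
    ultimately show ?thesis by blast
  next
    case True
    \<comment> \<open>With \<open>q = X\<close>, failing at \<open>q\<close> means sending
      \<open>Y\<close> to \<open>b\<close> and \<open>X\<close> to \<open>d\<close>. Pairing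
      \<open>a\<close> with \<open>d\<close> instead of \<open>b\<close> keeps the two sets
      disjoint.\<close>
    let ?U = "(S a d X Y - {b}) \<union> (S b d Y X - {a})"
    have "2 * s - 1 \<le> card ?U"
    proof (rule bound[OF finS finS cS(1)[OF abd(1,3,5)] cS(2)[OF abd(2,3,6)]])
      show "S a d X Y \<inter> S b d Y X = {}" using X(3) by (auto simp: S_def)
      show "\<not> (b \<in> S a d X Y \<and> a \<in> S b d Y X)"
        using X(3) insert_commute[of a b "{}"] by (auto simp: S_def)
    qed
    moreover have "\<forall>v\<in>?U. \<not> fits3 (\<chi> {v, a}) (\<chi> {v, b}) (\<chi> {v, d}) p q"
    proof
      fix v assume "v \<in> ?U"
      then consider "\<chi> {v, a} = X \<and> \<chi> {v, d} = Y" | "\<chi> {v, b} = Y \<and> \<chi> {v, d} = X"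
        by (auto simp: S_def)
      then show "\<not> fits3 (\<chi> {v, a}) (\<chi> {v, b}) (\<chi> {v, d}) p q"
        using X(3,4) True by cases (simp_all add: fits3_def)
    qed
    moreover have "?U \<subseteq> {..<?n} - {a, b, d}" by (auto simp: S_def)
    ultimately show ?thesis by blast
  qed
  then obtain U where U: "U \<subseteq> {..<?n} - {a, b, d}" "2 * s - 1 \<le> card U"
    "\<forall>v\<in>U. \<not> fits3 (\<chi> {v, a}) (\<chi> {v, b}) (\<chi> {v, d}) p q" by blast
  have "{v \<in> {..<?n} - {a, b, d}. fits3 (\<chi> {v, a}) (\<chi> {v, b}) (\<chi> {v, d}) p q} \<subseteq> {..<?n} - {a, b, d} - U"
    using U(3) by auto
  then have "2 * s \<le> card ({..<?n} - {a, b, d} - U)"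
    using le card_mono[of "{..<?n} - {a, b, d} - U"] by (meson finite_Diff finite_lessThan le_trans)
  also have "\<dots> = card ({..<?n} - {a, b, d}) - card U"
    using U by (intro card_Diff_subset) (auto intro: finite_subset)
  also have "card ({..<?n} - {a, b, d}) = 4 * s - 2" using abd by (simp add: card_Diff_subset)
  finally show False using U(2) \<open>s > 0\<close> by linarith
qed

theorem theorem1p9:
  fixes t :: nat
  assumes "t > 0"
  shows "(\<forall>n. t mod 3 = 0 \<and> n = 4 * t div 3 + 1 \<and>
            SRG_exists n ((n - 1) div 2) ((n - 5) div 4) ((n - 1) div 4) \<longrightarrow>
            orderable_ramsey2 (complete_bipartite 2 t) = CR (complete_bipartite 2 t) (complete_graph 3) \<and>
            CR (complete_bipartite 2 t) (complete_graph 3) = enat (4 * t div 3 + 2)) \<and>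
         (t mod 2 = 0 \<and> SRG_exists (2 * t + 1) t (t div 2 - 1) (t div 2) \<longrightarrow>
            orderable_ramsey2 (complete_bipartite 3 t) = CR (complete_bipartite 3 t) (complete_graph 3) \<and>
            CR (complete_bipartite 3 t) (complete_graph 3) = enat (2 * t + 2))"
proof (intro conjI allI impI; elim conjE)
  fix n
  assume t3: "t mod 3 = 0" and n: "n = 4 * t div 3 + 1"
    and srg: "SRG_exists n ((n - 1) div 2) ((n - 5) div 4) ((n - 1) div 4)"
  define s where "s = t div 3"
  have t: "t = 3 * s" "s > 0" using t3 assms by (auto simp: s_def)
  have n': "n = 4 * s + 1" "4 * t div 3 + 2 = Suc (4 * s + 1)" by (simp_all add: n t)
  \<comment> \<open>\<open>t > 0\<close> gives \<open>n \<ge> 5\<close>, so \<open>n - 5\<close> is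
    a true difference.\<close>
  have "(n - 5) div 4 = s - 1"
  proof -
    have "n - 5 = 4 * (s - 1)" using t(2) by (simp add: n')
    then show ?thesis by simp
  qed
  then have srg': "SRG_exists (4 * s + 1) (2 * s) (s - 1) s" using srg by (simp add: n')
  obtain \<chi> :: "nat set \<Rightarrow> nat" where \<chi>: "range \<chi> \<subseteq> {0, 1}"
    "\<And>a b X Y. a < 4 * s + 1 \<Longrightarrow> b < 4 * s + 1 \<Longrightarrow> a \<noteq> b \<Longrightarrow> X \<in> {0, 1} \<Longrightarrow> Y \<in> {0, 1} \<Longrightarrow> X \<noteq> Y \<Longrightarrow>
      card {v \<in> {..<4 * s + 1} - {a, b}. \<chi> {v, a} = X \<and> \<chi> {v, b} = Y} = s"
    by (rule conference_coloring[OF srg' t(2)]) blast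
  have low: "\<not> has_orderable (complete_bipartite 2 t) (4 * s + 1) \<chi>"
    unfolding t(1) by (rule K2_lower[OF t(2) \<chi>(2)])
  have up: "has_orderable (complete_bipartite 2 t) (Suc (4 * s + 1)) \<psi> \<or>
      (\<exists>C. copy_of_in C (complete_graph 3) (complete_graph (Suc (4 * s + 1))) \<and> rainbow C \<psi>)"
    for \<psi> :: "nat set \<Rightarrow> nat"
    using K2_upper[of s \<psi>] by (simp add: t(1))
  note eq = orderable_ramsey_eqI[OF up \<chi>(1) low]
  show "orderable_ramsey2 (complete_bipartite 2 t) = CR (complete_bipartite 2 t) (complete_graph 3)"
    using eq by simp
  show "CR (complete_bipartite 2 t) (complete_graph 3) = enat (4 * t div 3 + 2)"
    using eq(2) n'(2) by simp
next
  assume t2: "t mod 2 = 0" and srg: "SRG_exists (2 * t + 1) t (t div 2 - 1) (t div 2)"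
  define s where "s = t div 2"
  have t: "t = 2 * s" "s > 0" using t2 assms by (auto simp: s_def)
  have srg': "SRG_exists (4 * s + 1) (2 * s) (s - 1) s" using srg by (simp add: t)
  obtain \<chi> :: "nat set \<Rightarrow> nat" where \<chi>: "range \<chi> \<subseteq> {0, 1}"
    "\<And>a b X Y. a < 4 * s + 1 \<Longrightarrow> b < 4 * s + 1 \<Longrightarrow> a \<noteq> b \<Longrightarrow> X \<in> {0, 1} \<Longrightarrow> Y \<in> {0, 1} \<Longrightarrow> X \<noteq> Y \<Longrightarrow>
      card {v \<in> {..<4 * s + 1} - {a, b}. \<chi> {v, a} = X \<and> \<chi> {v, b} = Y} = s"
    by (rule conference_coloring[OF srg' t(2)]) blast
  have low: "\<not> has_orderable (complete_bipartite 3 t) (4 * s + 1) \<chi>"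
    unfolding t(1) by (rule K3_lower[OF t(2) \<chi>(2)])
  have up: "has_orderable (complete_bipartite 3 t) (Suc (4 * s + 1)) \<psi> \<or>
      (\<exists>C. copy_of_in C (complete_graph 3) (complete_graph (Suc (4 * s + 1))) \<and> rainbow C \<psi>)"
    for \<psi> :: "nat set \<Rightarrow> nat"
    using K3_upper[OF t(2), of \<psi>] by (simp add: t(1))
  note eq = orderable_ramsey_eqI[OF up \<chi>(1) low]
  show "orderable_ramsey2 (complete_bipartite 3 t) = CR (complete_bipartite 3 t) (complete_graph 3)"
    using eq by simp
  show "CR (complete_bipartite 3 t) (complete_graph 3) = enat (2 * t + 2)"
    using eq(2) by (simp add: t(1))
qed

end
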